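(* Amorphic complexity is zero for all isometries and Morse-Smale systems, but equals one for Sturmian subshifts and Denjoy examples on the circle. That is: (i) if $X$ is a compact metric space and $f:X\to X$ is an isometry, then $\mathrm{ac}(f)=0$; (ii) if $X$ is a compact metric space and $f:X\to X$ is Morse-Smale, then $\mathrm{ac}(f)=0$; (iii) if $\alpha\in(0,1)$ is irrational and $(\Sigma_\alpha,\sigma)$ is the Sturmian subshift generated by $\alpha$, then $\mathrm{ac}(\sigma|_{\Sigma_\alpha})=1$; (iv) if $f:\mathbb{T}^1\to\mathbb{T}^1$ is a Denjoy homeomorphism, then $\mathrm{ac}(f)=1$.
   Context: Amorphic complexity. Let $(X,d)$ be a metric space and $f:X\to X$. For $x,y\in X$, $\delta>0$, $n\in\mathbb{N}$ let $S_n(f,\delta,x,y)=\#\{0\le k<n \mid d(f^k(x),f^k(y))\ge\delta\}$. For $\nu\in(0,1]$, points $x,y$ are $(f,\delta,\nu)$-separated if $\limsup_{n\to\infty} S_n(f,\delta,x,y)/n\ge\nu$. A subset $S\subseteq X$ is $(f,\delta,\nu)$-separated if all pairs of distinct points of $S$ are $(f,\delta,\nu)$-separated. $\operatorname{Sep}(f,\delta,\nu)$ is the largest cardinality (possibly $\infty$) of an $(f,\delta,\nu)$-separated subset of $X$. Set $\underline{\mathrm{ac}}(f)=\sup_{\delta>0}\liminf_{\nu\to0}\frac{\log\operatorname{Sep}(f,\delta,\nu)}{-\log\nu}$ and $\overline{\mathrm{ac}}(f)=\sup_{\delta>0}\limsup_{\nu\to0}\frac{\log\operatorname{Sep}(f,\delta,\nu)}{-\log\nu}$;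 if both coincide, the common value is $\mathrm{ac}(f)$. (A statement $\mathrm{ac}(f)=c$ includes that both coincide.) Morse-Smale. A continuous map $f$ on a compact metric space is called Morse-Smale if its non-wandering set $\Omega(f)$ is finite. Sturmian subshifts. Let $\mathbb{T}^1=\mathbb{R}/\mathbb{Z}$ and $R_\alpha(x)=x+\alpha \bmod 1$. Equip $\{0,1\}^{\mathbb{Z}}$ with the metric $\rho(x,y)=2^{-j}$, $j=\min\{|k| : x_k\ne y_k\}$ for $x\neq y$, and let $\sigma$ be the left shift. For irrational $\alpha\in(0,1)$ let $\phi_\alpha:\mathbb{T}^1\to\{0,1\}$ be $\phi_\alpha(x)=0$ if $x\in[0,1-\alpha)$ and $\phi_\alpha(x)=1$ if $x\in[1-\alpha,1)$. Then $\Sigma_\alpha$ is the closure of $\{(\phi_\alpha(R_\alpha^k(x)))_{k\in\mathbb{Z}} \mid x\in\mathbb{T}^1\}$ in $\{0,1\}^{\mathbb{Z}}$. Denjoy homeomorphisms. A Denjoy example (Denjoy homeomorphism) is an orientation-preserving homeomorphism of $\mathbb{T}^1$ with irrational rotation number $\alpha$ that is not topologically conjugate to the rotation $R_\alpha$. $\mathbb{T}^1$ carries its usual metric. *)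

theory Defs
  imports "HOL-Analysis.Analysis" "HOL-Library.Z2"
begin

section \<open>Amorphic complexity\<close>

text \<open>
  A system is given by a carrier \<open>X\<close>, a distance \<open>d\<close> and a self-map \<open>f\<close>; only
  the restrictions of \<open>d\<close> and \<open>f\<close> to \<open>X\<close> matter as long as \<open>f\<close> maps \<open>X\<close> into itself.
\<close>

definition sep_count :: "('a \<Rightarrow> 'a \<Rightarrow> real) \<Rightarrow> ('a \<Rightarrow> 'a) \<Rightarrow> real \<Rightarrow> 'a \<Rightarrow> 'a \<Rightarrow> nat \<Rightarrow> nat" where
  "sep_count d f \<delta> x y n = card {k. k < n \<and> d ((f ^^ k) x) ((f ^^ k) y) \<ge> \<delta>}"

definition points_separated ::
  "('a \<Rightarrow> 'a \<Rightarrow> real) \<Rightarrow> ('a \<Rightarrow> 'a) \<Rightarrow> real \<Rightarrow> real \<Rightarrow> 'a \<Rightarrow> 'a \<Rightarrow> bool" where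
  "points_separated d f \<delta> \<nu> x y \<longleftrightarrow>
     limsup (\<lambda>n. ereal (real (sep_count d f \<delta> x y n) / real n)) \<ge> ereal \<nu>"

definition set_separated ::
  "('a \<Rightarrow> 'a \<Rightarrow> real) \<Rightarrow> ('a \<Rightarrow> 'a) \<Rightarrow> real \<Rightarrow> real \<Rightarrow> 'a set \<Rightarrow> bool" where
  "set_separated d f \<delta> \<nu> S \<longleftrightarrow>
     (\<forall>x\<in>S. \<forall>y\<in>S. x \<noteq> y \<longrightarrow> points_separated d f \<delta> \<nu> x y)"

definition Sep ::
  "'a set \<Rightarrow> ('a \<Rightarrow> 'a \<Rightarrow> real) \<Rightarrow> ('a \<Rightarrow> 'a) \<Rightarrow> real \<Rightarrow> real \<Rightarrow> enat" where
  "Sep X d f \<delta> \<nu> =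
     (SUP S \<in> {S. S \<subseteq> X \<and> set_separated d f \<delta> \<nu> S}. if finite S then enat (card S) else \<infinity>)"

definition ln_enat :: "enat \<Rightarrow> ereal" where
  "ln_enat m = (case m of enat k \<Rightarrow> if k = 0 then - \<infinity> else ereal (ln (real k)) | \<infinity> \<Rightarrow> \<infinity>)"

definition lower_ac :: "'a set \<Rightarrow> ('a \<Rightarrow> 'a \<Rightarrow> real) \<Rightarrow> ('a \<Rightarrow> 'a) \<Rightarrow> ereal" where
  "lower_ac X d f =
     (SUP \<delta> \<in> {0<..}. Liminf (at_right 0) (\<lambda>\<nu>. ln_enat (Sep X d f \<delta> \<nu>) / ereal (- ln \<nu>)))"

definition upper_ac :: "'a set \<Rightarrow> ('a \<Rightarrow> 'a \<Rightarrow> real) \<Rightarrow> ('a \<Rightarrow> 'a) \<Rightarrow> ereal" where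
  "upper_ac X d f =
     (SUP \<delta> \<in> {0<..}. Limsup (at_right 0) (\<lambda>\<nu>. ln_enat (Sep X d f \<delta> \<nu>) / ereal (- ln \<nu>)))"

definition has_ac :: "'a set \<Rightarrow> ('a \<Rightarrow> 'a \<Rightarrow> real) \<Rightarrow> ('a \<Rightarrow> 'a) \<Rightarrow> ereal \<Rightarrow> bool" where
  "has_ac X d f c \<longleftrightarrow> lower_ac X d f = c \<and> upper_ac X d f = c"


section \<open>Isometries and Morse-Smale maps\<close>

definition compact_metric_space :: "'a set \<Rightarrow> ('a \<Rightarrow> 'a \<Rightarrow> real) \<Rightarrow> bool" where
  "compact_metric_space X d \<longleftrightarrow>
     Metric_space X d \<and> compact_space (Metric_space.mtopology X d)"

text \<open>Isometries are distance-preserving maps; surjectivity is not required.\<close>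

definition isometry_map :: "'a set \<Rightarrow> ('a \<Rightarrow> 'a \<Rightarrow> real) \<Rightarrow> ('a \<Rightarrow> 'a) \<Rightarrow> bool" where
  "isometry_map X d f \<longleftrightarrow> f \<in> X \<rightarrow> X \<and> (\<forall>x\<in>X. \<forall>y\<in>X. d (f x) (f y) = d x y)"

definition nonwandering_set :: "'a set \<Rightarrow> ('a \<Rightarrow> 'a \<Rightarrow> real) \<Rightarrow> ('a \<Rightarrow> 'a) \<Rightarrow> 'a set" where
  "nonwandering_set X d f =
     {x \<in> X. \<forall>U. openin (Metric_space.mtopology X d) U \<and> x \<in> U
                \<longrightarrow> (\<exists>n\<ge>1. (f ^^ n) ` U \<inter> U \<noteq> {})}"

definition morse_smale :: "'a set \<Rightarrow> ('a \<Rightarrow> 'a \<Rightarrow> real) \<Rightarrow> ('a \<Rightarrow> 'a) \<Rightarrow> bool" where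
  "morse_smale X d f \<longleftrightarrow>
     continuous_map (Metric_space.mtopology X d) (Metric_space.mtopology X d) f
     \<and> finite (nonwandering_set X d f)"


section \<open>The circle\<close>

quotient_type circle = real / "\<lambda>x y :: real. x - y \<in> \<int>"
  morphisms circle_rep to_circle
proof (rule equivpI)
  show "reflp (\<lambda>x y :: real. x - y \<in> \<int>)"
    by (rule reflpI) simp
  show "symp (\<lambda>x y :: real. x - y \<in> \<int>)"
    by (rule sympI) (metis Ints_minus minus_diff_eq)
  show "transp (\<lambda>x y :: real. x - y \<in> \<int>)"
  proof (rule transpI)
    fix x y z :: real
    assume "x - y \<in> \<int>" "y - z \<in> \<int>"
    then have "(x - y) + (y - z) \<in> \<int>" by (rule Ints_add)
    then show "x - z \<in> \<int>" by simp
  qed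
qed

lemma infdist_Ints_shift:
  fixes u v :: real
  assumes "u - v \<in> \<int>"
  shows "infdist u \<int> = infdist v \<int>"
proof -
  have *: "infdist v \<int> \<le> infdist u \<int>" if "u - v \<in> \<int>" for u v :: real
  proof -
    have "infdist v \<int> \<le> dist u a" if "a \<in> \<int>" for a
    proof -
      have "a - (u - v) \<in> \<int>" using that \<open>u - v \<in> \<int>\<close> by simp
      then have "infdist v \<int> \<le> dist v (a - (u - v))" by (rule infdist_le)
      also have "\<dots> = dist u a" by (simp add: dist_real_def)
      finally show ?thesis .
    qed
    moreover have "(\<int> :: real set) \<noteq> {}" using Ints_0 by blast
    ultimately show ?thesis by (auto simp: infdist_notempty intro!: cINF_greatest)
  qed
  have "v - u \<in> \<int>" using assms by (metis Ints_minus minus_diff_eq)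
  with * assms show ?thesis by (metis order_antisym)
qed

lemma infdist_Ints_add_le:
  fixes u v :: real
  shows "infdist (u + v) \<int> \<le> infdist u \<int> + infdist v \<int>"
proof -
  have ne: "(\<int> :: real set) \<noteq> {}" using Ints_0 by blast
  have cl: "closed (\<int> :: real set)" by simp
  obtain a where a: "a \<in> \<int>" "infdist u \<int> = dist u a"
    using infdist_attains_inf[OF cl ne] by metis
  obtain b where b: "b \<in> \<int>" "infdist v \<int> = dist v b"
    using infdist_attains_inf[OF cl ne] by metis
  have "infdist (u + v) \<int> \<le> dist (u + v) (a + b)"
    using a b by (intro infdist_le) simp
  also have "\<dots> \<le> dist u a + dist v b" by (rule dist_triangle_add)
  finally show ?thesis using a b by simp
qed

text \<open>
  The usual metric on \<open>\<real>/\<int>\<close>: the least distance between representatives, that is,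
  the distance from the difference \<open>x - y\<close> to the nearest integer.
\<close>

instantiation circle :: metric_space
begin

lift_definition dist_circle :: "circle \<Rightarrow> circle \<Rightarrow> real" is
  "\<lambda>x y. infdist (x - y) \<int>"
proof -
  fix x x' y y' :: real
  assume "x - x' \<in> \<int>" "y - y' \<in> \<int>"
  then have "(x - x') - (y - y') \<in> \<int>" by (rule Ints_diff)
  then have "(x - y) - (x' - y') \<in> \<int>" by (simp add: algebra_simps)
  then show "infdist (x - y) \<int> = infdist (x' - y') \<int>" by (rule infdist_Ints_shift)
qed

definition uniformity_circle :: "(circle \<times> circle) filter" where
  "uniformity_circle = (INF e\<in>{0<..}. principal {(x, y). dist x y < e})"

definition open_circle :: "circle set \<Rightarrow> bool" where
  "open_circle U \<longleftrightarrow> (\<forall>x\<in>U. \<forall>\<^sub>F (x', y) in uniformity. x' = x \<longrightarrow> y \<in> U)"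

instance
proof
  fix x y z :: circle
  show "dist x y = 0 \<longleftrightarrow> x = y"
  proof transfer
    fix x y :: real
    have "(\<int> :: real set) \<noteq> {}" using Ints_0 by blast
    then show "infdist (x - y) \<int> = 0 \<longleftrightarrow> x - y \<in> \<int>"
      using in_closed_iff_infdist_zero[of "\<int> :: real set" "x - y"] by simp
  qed
  show "dist x y \<le> dist x z + dist y z"
  proof transfer
    fix x y z :: real
    have minus_le: "infdist (- u) \<int> \<le> infdist u \<int>" for u :: real
    proof -
      have cl: "closed (\<int> :: real set)" and ne: "(\<int> :: real set) \<noteq> {}"
        using Ints_0 by (simp, blast)
      obtain a where a: "a \<in> \<int>" "infdist u \<int> = dist u a"
        using infdist_attains_inf[OF cl ne] by metis
      have "infdist (- u) \<int> \<le> dist (- u) (- a)" using a by (intro infdist_le) simp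
      then show ?thesis using a by (simp add: dist_real_def abs_minus_commute)
    qed
    have "infdist (x - y) \<int> \<le> infdist (x - z) \<int> + infdist (- (y - z)) \<int>"
      using infdist_Ints_add_le[of "x - z" "- (y - z)"] by simp
    then show "infdist (x - y) \<int> \<le> infdist (x - z) \<int> + infdist (y - z) \<int>"
      using minus_le[of "y - z"] by simp
  qed
qed (rule uniformity_circle_def open_circle_def)+

end

lift_definition rotation :: "real \<Rightarrow> circle \<Rightarrow> circle" is "\<lambda>\<alpha> x. x + \<alpha>"
  by simp


section \<open>Sturmian subshifts\<close>

definition shift_dist :: "(int \<Rightarrow> bit) \<Rightarrow> (int \<Rightarrow> bit) \<Rightarrow> real" where
  "shift_dist x y = (if x = y then 0 else 1 / 2 ^ (LEAST j. \<exists>k. j = nat \<bar>k\<bar> \<and> x k \<noteq> y k))"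

lemma Metric_space_shift_dist: "Metric_space UNIV shift_dist"
proof
  fix x y z :: "int \<Rightarrow> bit"
  show "0 \<le> shift_dist x y" by (simp add: shift_dist_def)
  have "(\<lambda>j. \<exists>k. j = nat \<bar>k\<bar> \<and> x k \<noteq> y k) = (\<lambda>j. \<exists>k. j = nat \<bar>k\<bar> \<and> y k \<noteq> x k)"
    by metis
  moreover have "x = y \<longleftrightarrow> y = x" by blast
  ultimately show "shift_dist x y = shift_dist y x" unfolding shift_dist_def by presburger
  show "shift_dist x y = 0 \<longleftrightarrow> x = y" by (simp add: shift_dist_def)
  show "shift_dist x z \<le> shift_dist x y + shift_dist y z"
  proof (cases "x = y \<or> y = z \<or> x = z")
    case True
    then show ?thesis by (auto simp: shift_dist_def)
  next
    case False
    let ?L = "\<lambda>x y :: int \<Rightarrow> bit. LEAST j. \<exists>k. j = nat \<bar>k\<bar> \<and> x k \<noteq> y k"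
    from False obtain k0 where "x k0 \<noteq> z k0" by blast
    then have "\<exists>k. ?L x z = nat \<bar>k\<bar> \<and> x k \<noteq> z k"
      by (intro LeastI[of "\<lambda>j. \<exists>k. j = nat \<bar>k\<bar> \<and> x k \<noteq> z k" "nat \<bar>k0\<bar>"]) blast
    then obtain k where k: "?L x z = nat \<bar>k\<bar>" "x k \<noteq> z k" by blast
    have le: "shift_dist u v \<ge> 1 / 2 ^ nat \<bar>k\<bar>" if "u k \<noteq> v k" for u v
    proof -
      have "?L u v \<le> nat \<bar>k\<bar>" using that by (intro Least_le) blast
      then have "(2 :: real) ^ ?L u v \<le> 2 ^ nat \<bar>k\<bar>" by (rule power_increasing) simp
      moreover have "u \<noteq> v" using that by blast
      ultimately show ?thesis by (simp add: shift_dist_def frac_le)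
    qed
    have xz: "shift_dist x z = 1 / 2 ^ nat \<bar>k\<bar>" using False k by (simp add: shift_dist_def)
    have nn: "0 \<le> shift_dist u v" for u v by (simp add: shift_dist_def)
    from k(2) have "x k \<noteq> y k \<or> y k \<noteq> z k" by metis
    then show ?thesis using le[of x y] le[of y z] nn[of x y] nn[of y z] xz by linarith
  qed
qed

definition left_shift :: "(int \<Rightarrow> bit) \<Rightarrow> (int \<Rightarrow> bit)" where
  "left_shift x = (\<lambda>k. x (k + 1))"

text \<open>Integer iterates of a bijection.\<close>

definition int_iterate :: "('a \<Rightarrow> 'a) \<Rightarrow> int \<Rightarrow> 'a \<Rightarrow> 'a" where
  "int_iterate f k = (if 0 \<le> k then f ^^ nat k else inv f ^^ nat (- k))"

text \<open>The representative of a point of the circle in \<open>[0, 1)\<close> is its fractional part.\<close>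

lift_definition sturmian_coding :: "real \<Rightarrow> circle \<Rightarrow> bit" is
  "\<lambda>\<alpha> x. if frac x < 1 - \<alpha> then 0 else 1"
proof -
  fix \<alpha> x y :: real
  assume "x - y \<in> \<int>"
  then have "frac x = frac y" using frac_add_int_left[of "x - y" y] by simp
  then show "(if frac x < 1 - \<alpha> then 0 else 1 :: bit) = (if frac y < 1 - \<alpha> then 0 else 1)"
    by simp
qed

definition sturmian_sequence :: "real \<Rightarrow> circle \<Rightarrow> int \<Rightarrow> bit" where
  "sturmian_sequence \<alpha> x = (\<lambda>k. sturmian_coding \<alpha> (int_iterate (rotation \<alpha>) k x))"

definition sturmian_subshift :: "real \<Rightarrow> (int \<Rightarrow> bit) set" where
  "sturmian_subshift \<alpha> =
     Metric_space.mtopology UNIV shift_dist closure_of range (sturmian_sequence \<alpha>)"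


section \<open>Denjoy homeomorphisms\<close>

definition is_lift :: "(real \<Rightarrow> real) \<Rightarrow> (circle \<Rightarrow> circle) \<Rightarrow> bool" where
  "is_lift F f \<longleftrightarrow> continuous_on UNIV F \<and> (\<forall>x. f (to_circle x) = to_circle (F x))"

definition orientation_preserving_homeomorphism :: "(circle \<Rightarrow> circle) \<Rightarrow> bool" where
  "orientation_preserving_homeomorphism f \<longleftrightarrow>
     (\<exists>g. homeomorphism UNIV UNIV f g) \<and> (\<exists>F. is_lift F f \<and> strict_mono F)"

text \<open>
  For an orientation-preserving homeomorphism the rotation number is an element of
  \<open>\<real>/\<int>\<close>; the predicate says that the real number \<open>\<alpha>\<close> represents it. Changing the
  lift changes \<open>\<alpha>\<close> by an integer.
\<close>

definition has_rotation_number :: "(circle \<Rightarrow> circle) \<Rightarrow> real \<Rightarrow> bool" where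
  "has_rotation_number f \<alpha> \<longleftrightarrow>
     (\<exists>F. is_lift F f \<and> (\<forall>x. (\<lambda>n. ((F ^^ n) x - x) / real n) \<longlonglongrightarrow> \<alpha>))"

definition topologically_conjugate ::
  "('a::topological_space \<Rightarrow> 'a) \<Rightarrow> ('b::topological_space \<Rightarrow> 'b) \<Rightarrow> bool" where
  "topologically_conjugate f g \<longleftrightarrow>
     (\<exists>h h'. homeomorphism UNIV UNIV h h' \<and> h \<circ> f = g \<circ> h)"

definition denjoy_homeomorphism :: "(circle \<Rightarrow> circle) \<Rightarrow> bool" where
  "denjoy_homeomorphism f \<longleftrightarrow>
     orientation_preserving_homeomorphism f
     \<and> (\<exists>\<alpha>. \<alpha> \<notin> \<rat> \<and> has_rotation_number f \<alpha> \<and> \<not> topologically_conjugate f (rotation \<alpha>))"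

end

theory Submission
  imports Defs "HOL-Real_Asymp.Real_Asymp"
begin

text \<open>
  For an isometry, separation at time zero decides everything, so separation numbers are bounded by total
  boundedness. For a Morse-Smale map every orbit eventually shadows an orbit in the finite non-wandering
  set, and two orbits shadowing the same one are not separated.

  Sturmian subshifts and Denjoy homeomorphisms both come with a coordinate on the circle in which the
  dynamics is the rotation by \<open>\<alpha>\<close>, and two orbits are apart essentially when the moving arc between
  their coordinates contains one of finitely many cut points. The frequency of this event is comparable
  to the length of the arc, so that \<open>Sep\<close> grows like \<open>1 / \<nu>\<close>. For this no equidistribution theorem is
  needed: density of the orbit of the rotation yields about \<open>1 / \<ell>\<close> disjoint (or covering) translates of an
  arc of length \<open>\<ell>\<close>, all visited equally often. For a Denjoy homeomorphism with lift \<open>F\<close> the coordinate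
  is \<open>limsup (F\<^sup>n x - n \<alpha>)\<close>; it fails to be injective because \<open>f\<close> is not conjugate to the rotation,
  and an interval on which it is constant serves as cut point.
\<close>

section \<open>Separation numbers\<close>

lemma ln_enat_mono: "a \<le> b \<Longrightarrow> ln_enat a \<le> ln_enat b"
  by (cases a; cases b) (auto simp: ln_enat_def)

lemma ln_enat_enat: "0 < k \<Longrightarrow> ln_enat (enat k) = ereal (ln (real k))"
  by (simp add: ln_enat_def)

text \<open>An oversized separated set, infinite ones included, contains a separated subset of
  exactly \<open>Suc M\<close> points, so only sets of that size have to be refuted.\<close>

lemma Sep_leI:
  assumes "\<And>S. S \<subseteq> X \<Longrightarrow> finite S \<Longrightarrow> card S = Suc M \<Longrightarrow>
             \<exists>x\<in>S. \<exists>y\<in>S. x \<noteq> y \<and> \<not> points_separated d f \<delta> \<nu> x y"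
  shows "Sep X d f \<delta> \<nu> \<le> enat M"
  unfolding Sep_def
proof (rule SUP_least)
  fix S assume "S \<in> {S. S \<subseteq> X \<and> set_separated d f \<delta> \<nu> S}"
  then have S: "S \<subseteq> X" "set_separated d f \<delta> \<nu> S" by auto
  have "\<not> (\<exists>T\<subseteq>S. finite T \<and> card T = Suc M)"
  proof
    assume "\<exists>T\<subseteq>S. finite T \<and> card T = Suc M"
    then obtain T where T: "T \<subseteq> S" "finite T" "card T = Suc M" by blast
    from assms[of T] T S show False unfolding set_separated_def by blast
  qed
  then have "finite S" "\<not> Suc M \<le> card S"
    by (meson infinite_arbitrarily_large, meson obtain_subset_with_card_n)
  then show "(if finite S then enat (card S) else \<infinity>) \<le> enat M" by simp
qed

lemma card_le_Sep:
  assumes "S \<subseteq> X" "finite S" "set_separated d f \<delta> \<nu> S"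
  shows "enat (card S) \<le> Sep X d f \<delta> \<nu>"
  unfolding Sep_def using assms by (intro SUP_upper2[of S]) auto

lemma one_le_Sep:
  assumes "X \<noteq> {}"
  shows "1 \<le> Sep X d f \<delta> \<nu>"
proof -
  obtain x where "x \<in> X" using assms by blast
  then show ?thesis
    using card_le_Sep[of "{x}" X d f \<delta> \<nu>] by (simp add: set_separated_def one_enat_def)
qed

text \<open>Dividing by \<open>n\<close> removes the bounded error \<open>K\<close>, so a counting
  bound valid for all \<open>n\<close> passes to the upper density.\<close>

lemma points_separatedI:
  assumes "\<And>n. \<nu> * real n \<le> real (sep_count d f \<delta> x y n) + K"
  shows "points_separated d f \<delta> \<nu> x y"
proof -
  have "((\<lambda>n. ereal (\<nu> - K / real n)) \<longlongrightarrow> ereal \<nu>) sequentially"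
    unfolding lim_ereal by real_asymp
  then have "ereal \<nu> = limsup (\<lambda>n. ereal (\<nu> - K / real n))"
    by (intro lim_imp_Limsup[symmetric]) auto
  also have "\<dots> \<le> limsup (\<lambda>n. ereal (real (sep_count d f \<delta> x y n) / real n))"
  proof (intro Limsup_mono eventually_mono[OF eventually_gt_at_top[of 0]])
    fix n :: nat assume "0 < n"
    then show "ereal (\<nu> - K / real n) \<le> ereal (real (sep_count d f \<delta> x y n) / real n)"
      using assms[of n] by (simp add: pos_le_divide_eq left_diff_distrib)
  qed
  finally show ?thesis by (simp add: points_separated_def)
qed

lemma not_points_separatedI:
  assumes "\<And>n. real (sep_count d f \<delta> x y n) \<le> c * real n + K" "c < \<nu>"
  shows "\<not> points_separated d f \<delta> \<nu> x y"
proof -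
  have lim: "((\<lambda>n. ereal (c + K / real n)) \<longlongrightarrow> ereal c) sequentially"
    unfolding lim_ereal by real_asymp
  have "limsup (\<lambda>n. ereal (real (sep_count d f \<delta> x y n) / real n))
          \<le> limsup (\<lambda>n. ereal (c + K / real n))"
  proof (intro Limsup_mono eventually_mono[OF eventually_gt_at_top[of 0]])
    fix n :: nat assume "0 < n"
    then show "ereal (real (sep_count d f \<delta> x y n) / real n) \<le> ereal (c + K / real n)"
      using assms(1)[of n] by (simp add: field_simps)
  qed
  also have "\<dots> = ereal c" using lim by (intro lim_imp_Limsup) auto
  also have "\<dots> < ereal \<nu>" using assms(2) by simp
  finally show ?thesis by (simp add: points_separated_def)
qed

lemma not_points_separated_if_finite:
  assumes "finite {k. d ((f ^^ k) x) ((f ^^ k) y) \<ge> \<delta>}" "0 < \<nu>"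
  shows "\<not> points_separated d f \<delta> \<nu> x y"
proof (rule not_points_separatedI[OF _ assms(2)])
  fix n
  show "real (sep_count d f \<delta> x y n) \<le> 0 * real n + card {k. d ((f ^^ k) x) ((f ^^ k) y) \<ge> \<delta>}"
    unfolding sep_count_def using assms(1) by (auto intro!: card_mono)
qed

section \<open>From the growth of \<open>Sep\<close> to amorphic complexity\<close>

lemma lower_ac_le_upper_ac: "lower_ac X d f \<le> upper_ac X d f"
  unfolding lower_ac_def upper_ac_def
  by (intro SUP_mono) (use Liminf_le_Limsup[OF trivial_limit_at_right_real] in blast)

text \<open>Constant factors in \<open>Sep\<close> become the additive \<open>C\<close> under the
  logarithm and vanish in the quotient, which leaves the exponent \<open>c\<close>.\<close>

lemma tendsto_affine_neg_ln_quotient: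
  fixes c C :: real
  shows "((\<lambda>\<nu>. ereal (c * (- ln \<nu>) + C) / ereal (- ln \<nu>)) \<longlongrightarrow> ereal c) (at_right 0)"
proof -
  have "((\<lambda>\<nu>. (c * (- ln \<nu>) + C) / (- ln \<nu>)) \<longlongrightarrow> c) (at_right 0)" by real_asymp
  then have "((\<lambda>\<nu>. ereal ((c * (- ln \<nu>) + C) / (- ln \<nu>))) \<longlongrightarrow> ereal c) (at_right 0)"
    by (simp only: lim_ereal)
  then show ?thesis
  proof (rule Lim_transform_eventually)
    have "\<forall>\<^sub>F \<nu> in at_right 0. \<nu> \<in> {0 <..< (1::real)}"
      by (rule eventually_at_right_real) simp
    then show "\<forall>\<^sub>F \<nu> in at_right 0. ereal ((c * (- ln \<nu>) + C) / (- ln \<nu>))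
                 = ereal (c * (- ln \<nu>) + C) / ereal (- ln \<nu>)"
      by eventually_elim (subst ereal_divide, auto)
  qed
qed

lemma upper_ac_leI:
  assumes "\<And>\<delta>. \<delta> > 0 \<Longrightarrow> \<exists>C. \<forall>\<^sub>F \<nu> in at_right 0. ln_enat (Sep X d f \<delta> \<nu>) \<le> ereal (c * (- ln \<nu>) + C)"
  shows "upper_ac X d f \<le> ereal c"
  unfolding upper_ac_def
proof (rule SUP_least)
  fix \<delta> :: real assume "\<delta> \<in> {0<..}"
  with assms obtain C where C: "\<forall>\<^sub>F \<nu> in at_right 0. ln_enat (Sep X d f \<delta> \<nu>) \<le> ereal (c * (- ln \<nu>) + C)"
    by auto
  have "\<forall>\<^sub>F \<nu> in at_right 0. \<nu> \<in> {0 <..< (1::real)}"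
    by (rule eventually_at_right_real) simp
  with C have "\<forall>\<^sub>F \<nu> in at_right 0. ln_enat (Sep X d f \<delta> \<nu>) / ereal (- ln \<nu>)
                 \<le> ereal (c * (- ln \<nu>) + C) / ereal (- ln \<nu>)"
    by eventually_elim (rule ereal_divide_right_mono, auto)
  then have "Limsup (at_right 0) (\<lambda>\<nu>. ln_enat (Sep X d f \<delta> \<nu>) / ereal (- ln \<nu>))
        \<le> Limsup (at_right 0) (\<lambda>\<nu>. ereal (c * (- ln \<nu>) + C) / ereal (- ln \<nu>))"
    by (rule Limsup_mono)
  also have "\<dots> = ereal c"
    by (rule lim_imp_Limsup[OF trivial_limit_at_right_real tendsto_affine_neg_ln_quotient])
  finally show "Limsup (at_right 0) (\<lambda>\<nu>. ln_enat (Sep X d f \<delta> \<nu>) / ereal (- ln \<nu>)) \<le> ereal c" .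
qed

lemma le_lower_acI:
  assumes "\<delta> > 0" "\<forall>\<^sub>F \<nu> in at_right 0. ereal (c * (- ln \<nu>) + C) \<le> ln_enat (Sep X d f \<delta> \<nu>)"
  shows "ereal c \<le> lower_ac X d f"
proof -
  have "\<forall>\<^sub>F \<nu> in at_right 0. \<nu> \<in> {0 <..< (1::real)}"
    by (rule eventually_at_right_real) simp
  with assms(2) have "\<forall>\<^sub>F \<nu> in at_right 0. ereal (c * (- ln \<nu>) + C) / ereal (- ln \<nu>)
        \<le> ln_enat (Sep X d f \<delta> \<nu>) / ereal (- ln \<nu>)"
    by eventually_elim (rule ereal_divide_right_mono, auto)
  then have "Liminf (at_right 0) (\<lambda>\<nu>. ereal (c * (- ln \<nu>) + C) / ereal (- ln \<nu>))
      \<le> Liminf (at_right 0) (\<lambda>\<nu>. ln_enat (Sep X d f \<delta> \<nu>) / ereal (- ln \<nu>))"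
    by (rule Liminf_mono)
  also have "\<dots> \<le> lower_ac X d f"
    unfolding lower_ac_def using assms(1) by (intro SUP_upper) auto
  finally show ?thesis
    using lim_imp_Liminf[OF trivial_limit_at_right_real tendsto_affine_neg_ln_quotient, of c C] by simp
qed

text \<open>A bound uniform in \<nu> keeps the numerator bounded from above; singletons give
  \<open>Sep\<close> at least 1, hence a nonnegative logarithm.\<close>

lemma has_ac_zeroI:
  assumes "X \<noteq> {}"
    and "\<And>\<delta>. \<delta> > 0 \<Longrightarrow> \<exists>N::nat. \<forall>\<nu>. 0 < \<nu> \<and> \<nu> \<le> 1 \<longrightarrow> Sep X d f \<delta> \<nu> \<le> enat N"
  shows "has_ac X d f 0"
proof -
  have "upper_ac X d f \<le> ereal 0"
  proof (rule upper_ac_leI)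
    fix \<delta> :: real assume "\<delta> > 0"
    with assms(2) obtain N :: nat where N: "Sep X d f \<delta> \<nu> \<le> enat N" if "0 < \<nu>" "\<nu> \<le> 1" for \<nu>
      by blast
    have ev: "\<forall>\<^sub>F \<nu> in at_right 0. \<nu> \<in> {0 <..< (1::real)}"
      by (rule eventually_at_right_real) simp
    have "\<forall>\<^sub>F \<nu> in at_right 0. ln_enat (Sep X d f \<delta> \<nu>) \<le> ereal (0 * (- ln \<nu>) + ln (real (Suc N)))"
      using ev
    proof eventually_elim
      case (elim \<nu>)
      \<comment> \<open>\<open>Suc N\<close> avoids the value minus infinity that
        \<open>ln_enat\<close> takes at 0.\<close>
      then have "Sep X d f \<delta> \<nu> \<le> enat (Suc N)"
        using N[of \<nu>] by (auto intro: order_trans)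
      from ln_enat_mono[OF this] show ?case by (simp add: ln_enat_enat)
    qed
    then show "\<exists>C. \<forall>\<^sub>F \<nu> in at_right 0. ln_enat (Sep X d f \<delta> \<nu>) \<le> ereal (0 * (- ln \<nu>) + C)" ..
  qed
  moreover have "ereal 0 \<le> lower_ac X d f"
  proof (rule le_lower_acI[of 1 0 0])
    have "0 \<le> ln_enat (Sep X d f 1 \<nu>)" for \<nu>
      using ln_enat_mono[OF one_le_Sep[OF assms(1)], of d f 1 \<nu>]
      by (simp add: one_enat_def ln_enat_enat zero_ereal_def)
    then show "\<forall>\<^sub>F \<nu> in at_right 0. ereal (0 * (- ln \<nu>) + 0) \<le> ln_enat (Sep X d f 1 \<nu>)"
      by (simp add: zero_ereal_def)
  qed simp
  ultimately show ?thesis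
    using lower_ac_le_upper_ac[of X d f] unfolding has_ac_def zero_ereal_def
    by (auto intro: order_antisym order_trans)
qed

lemma Sep_antimono:
  assumes "\<nu> \<le> \<nu>'"
  shows "Sep X d f \<delta> \<nu>' \<le> Sep X d f \<delta> \<nu>"
proof -
  have "ereal \<nu> \<le> ereal \<nu>'" using assms by simp
  then have "set_separated d f \<delta> \<nu>' S \<Longrightarrow> set_separated d f \<delta> \<nu> S" for S
    unfolding set_separated_def points_separated_def by (meson order_trans)
  then show ?thesis unfolding Sep_def by (intro SUP_subset_mono) auto
qed

text \<open>The hypotheses say that \<open>Sep\<close> is of order 1/\<nu>. The lower bound is given
  only along the values \<open>1 / (q * M + 1)\<close>; monotonicity of \<open>Sep\<close> in \<nu>
  fills the gaps.\<close>

lemma has_ac_oneI: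
  assumes upper: "\<And>\<delta>. \<delta> > 0 \<Longrightarrow> \<exists>r. \<forall>M \<nu>. 0 < M \<and> 0 < \<nu> \<and> r < real M * \<nu> \<longrightarrow> Sep X d f \<delta> \<nu> \<le> enat M"
    and lower: "\<delta> > 0" "0 < q"
      "\<And>M. 0 < M \<Longrightarrow> enat M \<le> Sep X d f \<delta> (1 / (real (q * M) + 1))"
  shows "has_ac X d f 1"
proof -
  have "upper_ac X d f \<le> ereal 1"
  proof (rule upper_ac_leI)
    fix \<delta> :: real assume "\<delta> > 0"
    from upper[OF this] obtain r0 where
      r0: "\<And>M \<nu>. 0 < M \<Longrightarrow> 0 < \<nu> \<Longrightarrow> r0 < real M * \<nu> \<Longrightarrow> Sep X d f \<delta> \<nu> \<le> enat M" by metis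
    \<comment> \<open>With \<open>r\<close> at least 1 also \<open>r / \<nu>\<close> is at least 1,
      so rounding up to \<open>M\<close> costs at most a factor 2.\<close>
    define r where "r = max r0 1"
    have ev: "\<forall>\<^sub>F \<nu> in at_right 0. \<nu> \<in> {0 <..< (1::real)}"
      by (rule eventually_at_right_real) simp
    have "\<forall>\<^sub>F \<nu> in at_right 0. ln_enat (Sep X d f \<delta> \<nu>) \<le> ereal (1 * (- ln \<nu>) + ln (2 * r))"
      using ev
    proof eventually_elim
      case (elim \<nu>)
      then have \<nu>: "0 < \<nu>" "\<nu> < 1" by auto
      have r: "1 \<le> r" "r0 \<le> r" by (auto simp: r_def)
      define M where "M = nat \<lfloor>r / \<nu>\<rfloor> + 1"
      have "0 \<le> r / \<nu>" "1 \<le> r / \<nu>" using r \<nu> by (auto simp: field_simps)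
      then have "real M = of_int \<lfloor>r / \<nu>\<rfloor> + 1" by (simp add: M_def)
      then have "r / \<nu> < real M" and "real M \<le> r / \<nu> + 1" by linarith+
      moreover have "2 * r / \<nu> = r / \<nu> + r / \<nu>" by simp
      ultimately have M: "r0 < real M * \<nu>" "real M \<le> 2 * r / \<nu>"
        using \<nu> r \<open>1 \<le> r / \<nu>\<close> by (simp add: pos_divide_less_eq, linarith)
      have "0 < M" by (simp add: M_def)
      then have "Sep X d f \<delta> \<nu> \<le> enat M" using r0 \<nu>(1) M(1) by blast
      then have "ln_enat (Sep X d f \<delta> \<nu>) \<le> ereal (ln (real M))"
        using ln_enat_mono ln_enat_enat[OF \<open>0 < M\<close>] by metis
      also have "ln (real M) \<le> ln (2 * r / \<nu>)"
        using M(2) \<open>0 < M\<close> by (intro ln_mono) auto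
      also have "\<dots> = 1 * (- ln \<nu>) + ln (2 * r)"
        using \<nu> r by (simp add: ln_div)
      finally show ?case by simp
    qed
    then show "\<exists>C. \<forall>\<^sub>F \<nu> in at_right 0. ln_enat (Sep X d f \<delta> \<nu>) \<le> ereal (1 * (- ln \<nu>) + C)" ..
  qed
  moreover have "ereal 1 \<le> lower_ac X d f"
  proof (rule le_lower_acI[OF lower(1)])
    define Q where "Q = real q"
    have Q: "1 \<le> Q" using lower(2) by (simp add: Q_def)
    \<comment> \<open>Below this threshold \<open>1 / \<nu>\<close> exceeds
      \<open>2 + 2 * Q\<close>, so that rounding down to \<open>M\<close> costs at most a factor
      2.\<close>
    have ev: "\<forall>\<^sub>F \<nu> in at_right 0. \<nu> \<in> {0 <..< 1 / (2 * (1 + Q))}"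
      by (rule eventually_at_right_real) (use Q in simp)
    show "\<forall>\<^sub>F \<nu> in at_right 0. ereal (1 * (- ln \<nu>) + (- ln (2 * Q))) \<le> ln_enat (Sep X d f \<delta> \<nu>)"
      using ev
    proof eventually_elim
      case (elim \<nu>)
      then have \<nu>: "0 < \<nu>" "2 * (1 + Q) < 1 / \<nu>" using Q by (auto simp: field_simps)
      define y where "y = 1 / \<nu>"
      have y: "2 + 2 * Q < y" "1 < y" "0 < Q" using \<nu>(2) Q by (simp_all add: y_def)
      \<comment> \<open>The largest \<open>M\<close> with
        \<open>\<nu> \<le> 1 / (q * M + 1)\<close>.\<close>
      define M where "M = nat \<lfloor>(y - 1) / Q\<rfloor>"
      have "0 \<le> (y - 1) / Q" using y by simp
      then have "real M = of_int \<lfloor>(y - 1) / Q\<rfloor>" by (simp add: M_def)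
      then have "real M \<le> (y - 1) / Q" and "(y - 1) / Q < real M + 1" by linarith+
      with y have M: "real M * Q \<le> y - 1" "y - 1 < (real M + 1) * Q"
        by (simp_all add: pos_le_divide_eq pos_divide_less_eq)
      have M': "y / (2 * Q) < real M"
        using M(2) y Q by (simp add: pos_divide_less_eq algebra_simps)
      have "0 < y / (2 * Q)" using y by simp
      with M' have "0 < M" by (intro gr0I) simp
      have "real M * Q + 1 \<le> 1 / \<nu>" using M(1) by (simp add: y_def)
      then have "\<nu> \<le> 1 / (real M * Q + 1)"
        using \<nu>(1) Q by (simp add: pos_le_divide_eq add_nonneg_pos mult.commute)
      then have "\<nu> \<le> 1 / (real (q * M) + 1)" by (simp add: Q_def mult.commute)
      then have "enat M \<le> Sep X d f \<delta> \<nu>"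
        using lower(3)[OF \<open>0 < M\<close>] Sep_antimono order_trans by blast
      from ln_enat_mono[OF this] have "ereal (ln (real M)) \<le> ln_enat (Sep X d f \<delta> \<nu>)"
        using \<open>0 < M\<close> by (simp add: ln_enat_enat)
      moreover have "ln (y / (2 * Q)) \<le> ln (real M)"
        using M' \<open>0 < y / (2 * Q)\<close> by (intro ln_mono) auto
      moreover have "ln (y / (2 * Q)) = 1 * (- ln \<nu>) + (- ln (2 * Q))"
        using Q \<nu>(1) by (simp add: y_def ln_div ln_mult)
      ultimately show ?case by (metis ereal_less_eq(3) order_trans)
    qed
  qed
  ultimately show ?thesis
    using lower_ac_le_upper_ac[of X d f] unfolding has_ac_def one_ereal_def
    by (auto intro: order_antisym order_trans)
qed

section \<open>Isometries and Morse-Smale maps\<close>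

lemma funpow_in_carrier: "f \<in> X \<rightarrow> X \<Longrightarrow> x \<in> X \<Longrightarrow> (f ^^ k) x \<in> X"
  by (induction k) auto

lemma isometry_funpow:
  assumes "isometry_map X d f" "x \<in> X" "y \<in> X"
  shows "d ((f ^^ k) x) ((f ^^ k) y) = d x y"
proof (induction k)
  case (Suc k)
  have "f \<in> X \<rightarrow> X" using assms(1) by (simp add: isometry_map_def)
  from funpow_in_carrier[OF this assms(2)] funpow_in_carrier[OF this assms(3)] Suc assms(1)
  show ?case by (simp add: isometry_map_def)
qed simp

lemma not_inj_on_if_card_less:
  assumes "finite K" "g ` S \<subseteq> K" "card K < card S"
  obtains x y where "x \<in> S" "y \<in> S" "x \<noteq> y" "g x = g y"
  using assms card_inj_on_le[of g S K] unfolding inj_on_def by force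

text \<open>Two points sharing a centre of a finite cover by balls of radius \<delta>/2 stay closer
  than \<delta> forever, so the number of balls bounds \<open>Sep\<close> for every \<nu>.\<close>

theorem has_ac_isometry:
  assumes "compact_metric_space X d" "X \<noteq> {}" "isometry_map X d f"
  shows "has_ac X d f 0"
proof (rule has_ac_zeroI[OF assms(2)])
  interpret Metric_space X d using assms(1) by (simp add: compact_metric_space_def)
  fix \<delta> :: real assume "\<delta> > 0"
  have "mtotally_bounded X"
    using assms(1) compactin_imp_mtotally_bounded[of X]
    by (simp add: compact_metric_space_def compact_space_def)
  then obtain K where K: "finite K" "K \<subseteq> X" "X \<subseteq> (\<Union>x\<in>K. mball x (\<delta> / 2))"
    using \<open>\<delta> > 0\<close> unfolding mtotally_bounded_def by (meson half_gt_zero)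
  have "Sep X d f \<delta> \<nu> \<le> enat (card K)" if "0 < \<nu>" for \<nu>
  proof (rule Sep_leI)
    fix S assume S: "S \<subseteq> X" "card S = Suc (card K)"
    have "\<forall>x\<in>X. \<exists>p. p \<in> K \<and> d p x < \<delta> / 2"
      using K(3) by (auto simp: subset_iff)
    then obtain g where g: "\<forall>x\<in>X. g x \<in> K \<and> d (g x) x < \<delta> / 2" by metis
    obtain x y where xy: "x \<in> S" "y \<in> S" "x \<noteq> y" "g x = g y"
      using not_inj_on_if_card_less[of K g S] K(1) g S by (metis image_subsetI lessI subsetD)
    then have X: "x \<in> X" "y \<in> X" "g x \<in> X" using S g K(2) by auto
    have "d x y \<le> d (g x) x + d (g x) y" using X triangle commute by metis
    also have "\<dots> < \<delta>" using g[rule_format, of x] g[rule_format, of y] X xy by simp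
    finally have "finite {k. d ((f ^^ k) x) ((f ^^ k) y) \<ge> \<delta>}"
      using isometry_funpow[OF assms(3) X(1,2)] by simp
    from not_points_separated_if_finite[of \<delta> d f x y, OF this that] xy
    show "\<exists>x\<in>S. \<exists>y\<in>S. x \<noteq> y \<and> \<not> points_separated d f \<delta> \<nu> x y" by blast
  qed
  then show "\<exists>N::nat. \<forall>\<nu>. 0 < \<nu> \<and> \<nu> \<le> 1 \<longrightarrow> Sep X d f \<delta> \<nu> \<le> enat N" by blast
qed

section \<open>Morse-Smale maps: orbits near the finite non-wandering set\<close>

text \<open>The preimage of a neighbourhood of \<open>f x\<close> is a neighbourhood of
  \<open>x\<close>, and \<open>f\<close> carries its returns to returns of the original one.\<close>

lemma nonwandering_set_invariant:
  assumes "Metric_space X d"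
    and cont: "continuous_map (Metric_space.mtopology X d) (Metric_space.mtopology X d) f"
    and x: "x \<in> nonwandering_set X d f"
  shows "f x \<in> nonwandering_set X d f"
proof -
  interpret Metric_space X d by fact
  have "\<exists>n\<ge>1. (f ^^ n) ` U \<inter> U \<noteq> {}" if U: "openin mtopology U" "f x \<in> U" for U
  proof -
    let ?V = "{y \<in> X. f y \<in> U}"
    have "openin mtopology ?V" using openin_continuous_map_preimage[OF cont U(1)] by simp
    moreover have "x \<in> ?V" using x U(2) by (simp add: nonwandering_set_def)
    ultimately obtain n y where n: "n \<ge> 1" "y \<in> ?V" "(f ^^ n) y \<in> ?V"
      using x unfolding nonwandering_set_def by blast
    then have "(f ^^ n) (f y) \<in> U" "f y \<in> U" by (simp_all flip: funpow_swap1)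
    with n(1) show ?thesis by blast
  qed
  moreover have "f x \<in> X"
    using cont x by (auto simp: continuous_map_def nonwandering_set_def)
  ultimately show ?thesis by (simp add: nonwandering_set_def)
qed

text \<open>Two consecutive terms of the subsequence inside \<open>U\<close> give the positive
  return time \<open>r (Suc i) - r i\<close>.\<close>

lemma orbit_limit_nonwandering:
  assumes "Metric_space X d" "strict_mono r"
    and lim: "limitin (Metric_space.mtopology X d) (\<lambda>i. (f ^^ r i) x) l sequentially"
  shows "l \<in> nonwandering_set X d f"
proof -
  interpret Metric_space X d by fact
  have "\<exists>n\<ge>1. (f ^^ n) ` U \<inter> U \<noteq> {}" if U: "openin mtopology U" "l \<in> U" for U
  proof -
    obtain i where i: "(f ^^ r i) x \<in> U" "(f ^^ r (Suc i)) x \<in> U"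
      using lim U unfolding limitin_def eventually_sequentially by (metis le_Suc_eq order_refl)
    have less: "r i < r (Suc i)" using assms(2) by (simp add: strict_mono_Suc_iff)
    define n where "n = r (Suc i) - r i"
    have "r (Suc i) = n + r i" "n \<ge> 1" using less by (auto simp: n_def)
    then have "(f ^^ n) ((f ^^ r i) x) \<in> U" using i by (simp add: funpow_add)
    with i(1) \<open>n \<ge> 1\<close> show ?thesis by blast
  qed
  moreover have "l \<in> X" using lim by (simp add: limitin_def)
  ultimately show ?thesis by (simp add: nonwandering_set_def)
qed

text \<open>Infinitely many times away from the set would, by compactness, produce an accumulation
  point of the orbit there, but such points are non-wandering.\<close>

lemma eventually_near_nonwandering:
  assumes "compact_metric_space X d" "f \<in> X \<rightarrow> X" "x \<in> X" "\<epsilon> > 0"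
  shows "\<exists>N. \<forall>k\<ge>N. \<exists>q\<in>nonwandering_set X d f. d q ((f ^^ k) x) < \<epsilon>"
proof (rule ccontr)
  interpret Metric_space X d using assms(1) by (simp add: compact_metric_space_def)
  let ?B = "{k. \<forall>q\<in>nonwandering_set X d f. \<not> d q ((f ^^ k) x) < \<epsilon>}"
  assume "\<not> ?thesis"
  then have "infinite ?B" unfolding infinite_nat_iff_unbounded_le by blast
  then obtain r :: "nat \<Rightarrow> nat" where r: "strict_mono r" "\<And>i. r i \<in> ?B"
    using infinite_enumerate by blast
  have "range (\<lambda>i. (f ^^ r i) x) \<subseteq> X" using funpow_in_carrier[OF assms(2,3)] by auto
  then obtain l s where s: "l \<in> X" "strict_mono s"
    "limitin mtopology ((\<lambda>i. (f ^^ r i) x) \<circ> s) l sequentially"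
    using assms(1) unfolding compact_metric_space_def compact_space_sequentially by blast
  then have lim: "limitin mtopology (\<lambda>i. (f ^^ r (s i)) x) l sequentially" by (simp add: o_def)
  have "strict_mono (r \<circ> s)" using r(1) s(2) by (rule strict_mono_o)
  from orbit_limit_nonwandering[OF Metric_space_axioms this] lim
  have l: "l \<in> nonwandering_set X d f" by (simp add: o_def)
  obtain i where "(f ^^ r (s i)) x \<in> mball l \<epsilon>"
    using lim s(1) \<open>\<epsilon> > 0\<close> unfolding limitin_def eventually_sequentially
    by (meson centre_in_mball_iff openin_mball order_refl)
  with l r(2)[of "s i"] show False by auto
qed

text \<open>If the orbit is near \<open>q\<close> in the finite set, its next point is near
  \<open>f q\<close> by continuity and also near some \<open>p'\<close> in the set. Distinct points
  of the set are at least \<eta> apart, so \<open>p' = f q\<close>, and by induction the orbit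
  follows that of \<open>q\<close> forever.\<close>

lemma orbit_shadows_nonwandering:
  assumes "compact_metric_space X d" "morse_smale X d f" "x \<in> X" "\<epsilon> > 0"
  shows "\<exists>N0. \<forall>N\<ge>N0. \<exists>q\<in>nonwandering_set X d f. \<forall>j. d ((f ^^ j) q) ((f ^^ (N + j)) x) < \<epsilon>"
proof -
  interpret Metric_space X d using assms(1) by (simp add: compact_metric_space_def)
  let ?W = "nonwandering_set X d f"
  have cont: "continuous_map mtopology mtopology f" and fin: "finite ?W"
    using assms(2) by (auto simp: morse_smale_def)
  have fX: "f \<in> X \<rightarrow> X" using cont by (auto simp: continuous_map_def)
  have WX: "?W \<subseteq> X" by (auto simp: nonwandering_set_def)
  obtain \<eta> where \<eta>: "\<eta> > 0" "\<And>p q. p \<in> ?W \<Longrightarrow> q \<in> ?W \<Longrightarrow> p \<noteq> q \<Longrightarrow> \<eta> \<le> d p q"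
  proof
    \<comment> \<open>Inserting 1 keeps \<open>?D\<close> nonempty when the set has at most one
      point.\<close>
    let ?D = "insert 1 ((\<lambda>(p, q). d p q) ` {(p, q) \<in> ?W \<times> ?W. p \<noteq> q})"
    have "finite {(p, q) \<in> ?W \<times> ?W. p \<noteq> q}"
      by (rule finite_subset[of _ "?W \<times> ?W"]) (use fin in auto)
    then have fD: "finite ?D" by blast
    show "Min ?D > 0" using fD WX by (subst Min_gr_iff) (auto intro!: mdist_pos_less)
    show "Min ?D \<le> d p q" if "p \<in> ?W" "q \<in> ?W" "p \<noteq> q" for p q
      using fD that by (intro Min_le) auto
  qed
  define e1 where "e1 = min \<epsilon> (\<eta> / 2)"
  have e1: "e1 > 0" "e1 \<le> \<epsilon>" "2 * e1 \<le> \<eta>" using \<eta>(1) assms(4) by (auto simp: e1_def)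
  have "\<forall>q\<in>?W. \<exists>e>0. \<forall>y. y \<in> X \<and> d q y < e \<longrightarrow> d (f q) (f y) < e1"
    using cont e1(1) WX unfolding metric_continuous_map[OF Metric_space_axioms] by blast
  then obtain E where E: "\<And>q. q \<in> ?W \<Longrightarrow> E q > 0"
    "\<And>q y. q \<in> ?W \<Longrightarrow> y \<in> X \<Longrightarrow> d q y < E q \<Longrightarrow> d (f q) (f y) < e1" by metis
  define e2 where "e2 = Min (insert e1 (E ` ?W))"
  have e2: "e2 > 0" "e2 \<le> e1" "\<And>q. q \<in> ?W \<Longrightarrow> e2 \<le> E q"
    using fin E(1) e1(1) by (auto simp: e2_def)
  obtain N0 where N0: "\<And>k. k \<ge> N0 \<Longrightarrow> \<exists>q\<in>?W. d q ((f ^^ k) x) < e2"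
    using eventually_near_nonwandering[OF assms(1) fX assms(3) e2(1)] by blast
  have "\<exists>q\<in>?W. \<forall>j. d ((f ^^ j) q) ((f ^^ (N + j)) x) < \<epsilon>" if "N \<ge> N0" for N
  proof -
    obtain q where q: "q \<in> ?W" "d q ((f ^^ N) x) < e2" using N0 \<open>N \<ge> N0\<close> by blast
    have "(f ^^ j) q \<in> ?W \<and> d ((f ^^ j) q) ((f ^^ (N + j)) x) < e2" for j
    proof (induction j)
      case (Suc j)
      let ?p = "(f ^^ j) q" and ?y = "(f ^^ (N + j)) x"
      have y: "?y \<in> X" using funpow_in_carrier[OF fX assms(3)] .
      have near: "d (f ?p) (f ?y) < e1"
        using E(2)[of ?p ?y] e2(3)[of ?p] Suc y by force
      have fp: "f ?p \<in> ?W" using nonwandering_set_invariant[OF Metric_space_axioms cont] Suc by blast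
      obtain p' where p': "p' \<in> ?W" "d p' (f ?y) < e2"
        using N0[of "N + Suc j"] \<open>N \<ge> N0\<close> by auto
      have "d (f ?p) p' \<le> d (f ?p) (f ?y) + d p' (f ?y)"
        using triangle[of "f ?p" "f ?y" p'] fp p' WX y fX commute[of p' "f ?y"] by auto
      also have "\<dots> < \<eta>" using near p'(2) e1(3) e2(2) by linarith
      finally have "f ?p = p'" using \<eta>(2)[OF fp p'(1)] by force
      then show ?case using p' by simp
    qed (use q in simp)
    then show ?thesis using q(1) e2(2) e1(2) by (meson less_le_trans)
  qed
  then show ?thesis by blast
qed

theorem has_ac_morse_smale:
  assumes "compact_metric_space X d" "X \<noteq> {}" "morse_smale X d f"
  shows "has_ac X d f 0"
proof (rule has_ac_zeroI[OF assms(2)])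
  interpret Metric_space X d using assms(1) by (simp add: compact_metric_space_def)
  let ?W = "nonwandering_set X d f"
  have cont: "continuous_map mtopology mtopology f" and fin: "finite ?W"
    using assms(3) by (auto simp: morse_smale_def)
  have fX: "f \<in> X \<rightarrow> X" using cont by (auto simp: continuous_map_def)
  have WX: "?W \<subseteq> X" by (auto simp: nonwandering_set_def)
  fix \<delta> :: real assume "\<delta> > 0"
  have "Sep X d f \<delta> \<nu> \<le> enat (card ?W)" if "0 < \<nu>" for \<nu>
  proof (rule Sep_leI)
    fix S assume S: "S \<subseteq> X" "finite S" "card S = Suc (card ?W)"
    have "\<forall>x\<in>X. \<exists>N0. \<forall>N\<ge>N0. \<exists>q\<in>?W. \<forall>j. d ((f ^^ j) q) ((f ^^ (N + j)) x) < \<delta> / 2"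
      using orbit_shadows_nonwandering[OF assms(1,3)] \<open>\<delta> > 0\<close> by (meson half_gt_zero)
    then obtain T where T: "\<And>x N. x \<in> X \<Longrightarrow> N \<ge> T x \<Longrightarrow>
        \<exists>q\<in>?W. \<forall>j. d ((f ^^ j) q) ((f ^^ (N + j)) x) < \<delta> / 2" by metis
    \<comment> \<open>A common starting time, so that points of \<open>S\<close> with equal
      \<open>g\<close> shadow the same orbit at the same phase.\<close>
    define N where "N = Max (T ` S)"
    have "\<forall>x\<in>S. \<exists>q\<in>?W. \<forall>j. d ((f ^^ j) q) ((f ^^ (N + j)) x) < \<delta> / 2"
      using S by (intro ballI T) (auto simp: N_def)
    then obtain g where g: "\<And>x. x \<in> S \<Longrightarrow> g x \<in> ?W"
      "\<And>x j. x \<in> S \<Longrightarrow> d ((f ^^ j) (g x)) ((f ^^ (N + j)) x) < \<delta> / 2" by metis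
    obtain x y where xy: "x \<in> S" "y \<in> S" "x \<noteq> y" "g x = g y"
      using not_inj_on_if_card_less[of ?W g S] fin g(1) S(3) by (metis image_subsetI lessI)
    have near: "d ((f ^^ k) x) ((f ^^ k) y) < \<delta>" if "k \<ge> N" for k
    proof -
      obtain j where j: "k = N + j" using \<open>k \<ge> N\<close> le_Suc_ex by blast
      let ?p = "(f ^^ j) (g x)"
      have X: "(f ^^ k) x \<in> X" "(f ^^ k) y \<in> X" "?p \<in> X"
        using xy(1,2) S(1) g(1)[OF xy(1)] WX by (auto intro!: funpow_in_carrier[OF fX])
      have "d ((f ^^ k) x) ((f ^^ k) y) \<le> d ?p ((f ^^ k) x) + d ?p ((f ^^ k) y)"
        using triangle[OF X(1,3,2)] commute by metis
      also have "\<dots> < \<delta>" using g(2)[OF xy(1), of j] g(2)[OF xy(2), of j] xy(4) j by simp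
      finally show ?thesis .
    qed
    have "finite {k. d ((f ^^ k) x) ((f ^^ k) y) \<ge> \<delta>}"
      by (rule finite_subset[of _ "{..<N}"]) (use near in \<open>auto simp: not_less[symmetric]\<close>)
    from not_points_separated_if_finite[of \<delta> d f x y, OF this that] xy
    show "\<exists>x\<in>S. \<exists>y\<in>S. x \<noteq> y \<and> \<not> points_separated d f \<delta> \<nu> x y" by blast
  qed
  then show "\<exists>N::nat. \<forall>\<nu>. 0 < \<nu> \<and> \<nu> \<le> 1 \<longrightarrow> Sep X d f \<delta> \<nu> \<le> enat N" by blast
qed

section \<open>Visits of an irrational rotation to an interval\<close>

lemma irrational_orbit_dense:
  fixes \<alpha> t \<epsilon> :: real
  assumes "\<alpha> \<notin> \<rat>" "\<epsilon> > 0"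
  obtains j :: nat and l :: int where "\<bar>real j * \<alpha> + of_int l - t\<bar> < \<epsilon>"
proof -
  obtain h k where "k > 0" "\<bar>of_int k * \<alpha> - of_int h - t\<bar> < \<epsilon>"
    using sequence_of_fractional_parts_is_dense[OF assms] by blast
  then show ?thesis using that[of "nat k" "- h"] by (simp add: algebra_simps)
qed

lemma orbit_near_multiples:
  fixes \<alpha> \<epsilon> :: real
  assumes "\<alpha> \<notin> \<rat>" "\<epsilon> > 0"
  obtains j :: "nat \<Rightarrow> nat" and l :: "nat \<Rightarrow> int"
  where "\<And>i. \<bar>real (j i) * \<alpha> + of_int (l i) - real i / real m\<bar> < \<epsilon>"
proof -
  have "\<exists>(j::nat) l::int. \<bar>real j * \<alpha> + of_int l - real i / real m\<bar> < \<epsilon>" for i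
    using irrational_orbit_dense[OF assms] by metis
  then show ?thesis using that by metis
qed

text \<open>The translates of the interval by points of the orbit close to \<open>i / m\<close>, \<open>i < m\<close>, are disjoint
  modulo 1, and up to a bounded error each of them is visited as often as the interval itself.\<close>
lemma visits_upper:
  fixes \<alpha> a b :: real
  assumes \<alpha>: "\<alpha> \<notin> \<rat>" and m: "0 < m" "real m * (b - a) < 1"
  shows "\<exists>K. \<forall>n. m * card {k. k < n \<and> (\<exists>l::int. a \<le> real k * \<alpha> + l \<and> real k * \<alpha> + l \<le> b)} \<le> n + K"
proof -
  \<comment> \<open>Solves \<open>(b - a) + 2 * \<epsilon> = 1 / m\<close>: translates by points
    \<epsilon>-close to multiples of \<open>1 / m\<close> remain disjoint.\<close>
  define \<epsilon> where "\<epsilon> = (1 / real m - (b - a)) / 2"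
  have "b - a < 1 / real m" using m by (simp add: field_simps)
  then have "\<epsilon> > 0" by (simp add: \<epsilon>_def)
  obtain j l where jl: "\<And>i. \<bar>real (j i) * \<alpha> + of_int (l i) - real i / real m\<bar> < \<epsilon>"
    using orbit_near_multiples[OF \<alpha> \<open>\<epsilon> > 0\<close>] by blast
  define K where "K = (\<Sum>i<m. j i)"
  have jK: "j i \<le> K" if "i < m" for i
    unfolding K_def using that by (intro member_le_sum) auto
  have "m * card {k. k < n \<and> (\<exists>l::int. a \<le> real k * \<alpha> + l \<and> real k * \<alpha> + l \<le> b)} \<le> n + K" for n
  proof -
    let ?V = "{k. k < n \<and> (\<exists>l::int. a \<le> real k * \<alpha> + l \<and> real k * \<alpha> + l \<le> b)}"
    \<comment> \<open>Adding \<open>j i\<close> turns a visit to the interval into a visit to the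
      \<open>i\<close>-th translate; disjointness makes this injective, and the values stay below
      \<open>n + K\<close>.\<close>
    let ?h = "\<lambda>(i, k). k + j i"
    have "inj_on ?h ({..<m} \<times> ?V)"
    proof (rule inj_onI, clarify)
      fix i k L i' k' L'
      assume i: "i < m" "i' < m" and eq: "k + j i = k' + j i'"
        and L: "a \<le> real k * \<alpha> + of_int L" "real k * \<alpha> + of_int L \<le> b"
          "a \<le> real k' * \<alpha> + of_int L'" "real k' * \<alpha> + of_int L' \<le> b"
      have "real k * \<alpha> - real k' * \<alpha> = real (j i') * \<alpha> - real (j i) * \<alpha>"
        using arg_cong[OF eq, of "\<lambda>u. real u * \<alpha>"] by (simp add: algebra_simps)
      define D where "D = (l i' - l i) - (L - L')"
      have "\<bar>real i' / real m - real i / real m - of_int D\<bar> < (b - a) + 2 * \<epsilon>"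
        using jl[of i] jl[of i'] L \<open>real k * \<alpha> - real k' * \<alpha> = _\<close> unfolding D_def of_int_diff by linarith
      also have "\<dots> = 1 / real m" by (simp add: \<epsilon>_def field_simps)
      finally have "\<bar>real i' / real m - real i / real m - of_int D\<bar> * real m < 1"
        using m(1) by (simp add: field_simps)
      also have "\<bar>real i' / real m - real i / real m - of_int D\<bar> * real m
          = \<bar>(real i' / real m - real i / real m - of_int D) * real m\<bar>"
        by (simp add: abs_mult)
      also have "\<dots> = \<bar>of_int (int i' - int i - D * int m)\<bar>"
        using m(1) by (simp add: algebra_simps)
      \<comment> \<open>An integer of absolute value below 1 vanishes; as \<open>i\<close> and
        \<open>i'\<close> lie below \<open>m\<close>, this forces \<open>D = 0\<close>.\<close>
      finally have *: "int i' - int i - D * int m = 0" by linarith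
      have "D = 0"
      proof (rule ccontr)
        assume "D \<noteq> 0"
        then have "int m * 1 \<le> int m * \<bar>D\<bar>" by (intro mult_left_mono) auto
        then have "int m \<le> \<bar>D * int m\<bar>" by (simp add: abs_mult mult.commute)
        with * i show False by linarith
      qed
      with * have "i = i'" by simp
      with eq show "i = i' \<and> k = k'" by simp
    qed
    moreover have "?h ` ({..<m} \<times> ?V) \<subseteq> {..<n + K}" using jK by fastforce
    ultimately have "card ({..<m} \<times> ?V) \<le> card {..<n + K}" by (rule card_inj_on_le) simp
    then show ?thesis by (simp add: card_cartesian_product)
  qed
  then show ?thesis by blast
qed

text \<open>Dual to \<open>visits_upper\<close>: now the translates cover the circle, so every time
  from \<open>K\<close> on is a visiting time shifted by some \<open>j i\<close> with
  \<open>i < m\<close>.\<close>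

lemma visits_lower:
  fixes \<alpha> a b :: real
  assumes \<alpha>: "\<alpha> \<notin> \<rat>" and m: "0 < m" "1 < real m * (b - a)"
  shows "\<exists>K. \<forall>n. n \<le> m * card {k. k < n \<and> (\<exists>l::int. a < real k * \<alpha> + l \<and> real k * \<alpha> + l < b)} + K"
proof -
  define c where "c = (a + b) / 2"
  define h where "h = (b - a) / 2"
  have ab: "a = c - h" "b = c + h" by (simp_all add: c_def h_def field_simps)
  \<comment> \<open>Rounding to the nearest multiple of \<open>1 / m\<close> costs up to
    \<open>1 / (2 * m)\<close>; \<epsilon> is what remains of the half-length
    \<open>h\<close>.\<close>
  define \<epsilon> where "\<epsilon> = h - 1 / (2 * real m)"
  have "\<epsilon> > 0" using m by (simp add: \<epsilon>_def h_def field_simps)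
  obtain j l where jl: "\<And>i. \<bar>real (j i) * \<alpha> + of_int (l i) - real i / real m\<bar> < \<epsilon>"
    using orbit_near_multiples[OF \<alpha> \<open>\<epsilon> > 0\<close>] by blast
  define K where "K = (\<Sum>i<m. j i)"
  have jK: "j i \<le> K" if "i < m" for i
    unfolding K_def using that by (intro member_le_sum) auto
  have "n \<le> m * card {k. k < n \<and> (\<exists>l::int. a < real k * \<alpha> + l \<and> real k * \<alpha> + l < b)} + K" for n
  proof -
    let ?V = "{k. k < n \<and> (\<exists>l::int. a < real k * \<alpha> + l \<and> real k * \<alpha> + l < b)}"
    let ?h = "\<lambda>(i, k). k + j i"
    \<comment> \<open>Starting at \<open>K\<close> keeps the subtraction \<open>k - j i\<close> from
      truncating.\<close>
    have "{K..<n} \<subseteq> ?h ` ({..<m} \<times> ?V)"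
    proof
      fix k assume "k \<in> {K..<n}"
      then have k: "K \<le> k" "k < n" by auto
      define w where "w = real k * \<alpha> - c"
      \<comment> \<open>The integer nearest to \<open>m * w\<close>: its residue modulo
        \<open>m\<close> selects the translate, its quotient the integer shift.\<close>
      define N where "N = \<lfloor>real m * w + 1 / 2\<rfloor>"
      have N: "\<bar>real m * w - of_int N\<bar> \<le> 1 / 2" unfolding N_def by linarith
      define i where "i = nat (N mod int m)"
      have i: "i < m" and Nm: "N = (N div int m) * int m + int i"
        using m(1) by (auto simp: i_def nat_less_iff)
      define Q where "Q = N div int m"
      have "real m * (w - of_int Q - real i / real m) = real m * w - of_int N"
        using m(1) arg_cong[OF Nm, of real_of_int] by (simp add: Q_def algebra_simps)
      then have "real m * \<bar>w - of_int Q - real i / real m\<bar> \<le> 1 / 2"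
        using N by (metis abs_mult abs_of_nat)
      then have "\<bar>w - of_int Q - real i / real m\<bar> \<le> 1 / (2 * real m)"
        using m(1) by (simp add: field_simps)
      then have "\<bar>real k * \<alpha> - c - of_int Q - (real (j i) * \<alpha> + of_int (l i))\<bar> < h"
        using jl[of i] unfolding w_def \<epsilon>_def by linarith
      moreover have "real (k - j i) * \<alpha> = real k * \<alpha> - real (j i) * \<alpha>"
        using jK[OF i] k(1) by (simp add: of_nat_diff left_diff_distrib)
      ultimately have "a < real (k - j i) * \<alpha> + of_int (- Q - l i)"
        "real (k - j i) * \<alpha> + of_int (- Q - l i) < b"
        unfolding ab of_int_diff of_int_minus by linarith+
      then have "k - j i \<in> ?V" using k(2) by (auto intro: exI[of _ "- Q - l i"])
      moreover have "k = ?h (i, k - j i)" using jK[OF i] k(1) by simp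
      ultimately show "k \<in> ?h ` ({..<m} \<times> ?V)" using i by blast
    qed
    then have "card {K..<n} \<le> card (?h ` ({..<m} \<times> ?V))" by (intro card_mono) auto
    also have "\<dots> \<le> card ({..<m} \<times> ?V)" by (intro card_image_le) auto
    finally show ?thesis by (simp add: card_cartesian_product)
  qed
  then show ?thesis by blast
qed

section \<open>Systems coordinatised by an irrational rotation\<close>

text \<open>In the two criteria below \<open>p + \<int>\<close> plays the role of a cut point on the circle: up to finitely
  many times, orbits of points with coordinates \<open>s \<le> t\<close> are \<open>\<delta>\<close>-apart at time \<open>k\<close> only if
  (respectively, as soon as) the arc from \<open>s + k \<alpha>\<close> to \<open>t + k \<alpha>\<close> contains a cut point.\<close>

lemma pigeonhole_unit_interval:
  fixes g :: "'a \<Rightarrow> real"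
  assumes "card S = Suc M" "0 < M" "\<And>x. x \<in> S \<Longrightarrow> 0 \<le> g x \<and> g x < 1"
  obtains x y where "x \<in> S" "y \<in> S" "x \<noteq> y" "real M * \<bar>g x - g y\<bar> < 1"
proof -
  have "(\<lambda>x. \<lfloor>real M * g x\<rfloor>) ` S \<subseteq> {0..<int M}"
  proof
    fix i assume "i \<in> (\<lambda>x. \<lfloor>real M * g x\<rfloor>) ` S"
    then obtain x where x: "x \<in> S" "i = \<lfloor>real M * g x\<rfloor>" by blast
    from assms(2,3) x(1) have "0 \<le> real M * g x" "real M * g x < real M * 1"
      by (auto intro!: mult_strict_left_mono)
    then show "i \<in> {0..<int M}" using x(2) by (simp add: floor_less_iff)
  qed
  then obtain x y where xy: "x \<in> S" "y \<in> S" "x \<noteq> y" "\<lfloor>real M * g x\<rfloor> = \<lfloor>real M * g y\<rfloor>"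
    using not_inj_on_if_card_less[of "{0..<int M}" "\<lambda>x. \<lfloor>real M * g x\<rfloor>" S] assms(1)
    by (metis card_atLeastZeroLessThan_int finite_atLeastLessThan_int lessI nat_int)
  then have "\<bar>real M * g x - real M * g y\<bar> < 1" by linarith
  then have "real M * \<bar>g x - g y\<bar> < 1" by (simp flip: right_diff_distrib add: abs_mult)
  with xy that show ?thesis by blast
qed

lemma Sep_le_rotation_coordinate:
  fixes \<alpha> \<delta> \<nu> :: real and P :: "real set"
  assumes \<alpha>: "\<alpha> \<notin> \<rat>" and P: "finite P" and M: "0 < M" "0 < \<nu>" "real (card P) < real M * \<nu>"
    and g: "\<And>x. x \<in> X \<Longrightarrow> 0 \<le> g x \<and> g x < 1"
    and cut: "\<And>x y. x \<in> X \<Longrightarrow> y \<in> X \<Longrightarrow> finite {k. d ((f ^^ k) x) ((f ^^ k) y) \<ge> \<delta> \<and>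
      \<not> (\<exists>p\<in>P. \<exists>l::int. min (g x) (g y) + real k * \<alpha> \<le> p + l \<and> p + l \<le> max (g x) (g y) + real k * \<alpha>)}"
  shows "Sep X d f \<delta> \<nu> \<le> enat M"
proof (rule Sep_leI)
  fix S assume S: "S \<subseteq> X" "finite S" "card S = Suc M"
  obtain x y where xy: "x \<in> S" "y \<in> S" "x \<noteq> y" "real M * \<bar>g x - g y\<bar> < 1"
    using pigeonhole_unit_interval[of S M g] S M(1) g by (metis subsetD)
  define s t where "s = min (g x) (g y)" and "t = max (g x) (g y)"
  have "t - s = \<bar>g x - g y\<bar>" by (auto simp: s_def t_def)
  \<comment> \<open>The cut condition for \<open>p\<close>, solved for \<open>k * \<alpha>\<close>:
    a visit to \<open>[p - t, p - s]\<close>, an interval shorter than \<open>1 / M\<close>. The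
    integer changes sign.\<close>
  define V where "V = (\<lambda>p n. {k. k < n \<and>
    (\<exists>l::int. p - t \<le> real k * \<alpha> + l \<and> real k * \<alpha> + l \<le> p - s)})"
  have "\<exists>K. \<forall>n. M * card (V p n) \<le> n + K" for p
    unfolding V_def using xy(4) \<open>t - s = _\<close> by (intro visits_upper \<alpha> M(1)) simp
  then obtain K where K: "\<And>p n. M * card (V p n) \<le> n + K p" by metis
  define E where "E = {k. d ((f ^^ k) x) ((f ^^ k) y) \<ge> \<delta> \<and>
      \<not> (\<exists>p\<in>P. \<exists>l::int. s + real k * \<alpha> \<le> p + l \<and> p + l \<le> t + real k * \<alpha>)}"
  have E: "finite E" unfolding E_def s_def t_def using cut[of x y] xy S(1) by blast
  \<comment> \<open>Each cut point contributes frequency at most \<open>1 / M\<close>, which adds up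
    to \<open>card P / M < \<nu>\<close>; \<open>E\<close> and the \<open>K p\<close> are bounded
    errors.\<close>
  have count: "M * sep_count d f \<delta> x y n \<le> card P * n + ((\<Sum>p\<in>P. K p) + M * card E)" for n
  proof -
    have "{k. k < n \<and> d ((f ^^ k) x) ((f ^^ k) y) \<ge> \<delta>} \<subseteq> (\<Union>p\<in>P. V p n) \<union> E"
    proof
      fix k assume k: "k \<in> {k. k < n \<and> d ((f ^^ k) x) ((f ^^ k) y) \<ge> \<delta>}"
      show "k \<in> (\<Union>p\<in>P. V p n) \<union> E"
      proof (cases "k \<in> E")
        case False
        with k obtain p and l :: int where
          p: "p \<in> P" "s + real k * \<alpha> \<le> p + l" "p + l \<le> t + real k * \<alpha>"
          unfolding E_def by blast
        then have "p - t \<le> real k * \<alpha> + of_int (- l)" "real k * \<alpha> + of_int (- l) \<le> p - s" by simp_all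
        with k have "k \<in> V p n" unfolding V_def by blast
        with p(1) show ?thesis by blast
      qed blast
    qed
    then have "sep_count d f \<delta> x y n \<le> card ((\<Union>p\<in>P. V p n) \<union> E)"
      unfolding sep_count_def using P E by (intro card_mono) (auto simp: V_def)
    also have "\<dots> \<le> (\<Sum>p\<in>P. card (V p n)) + card E"
      using card_Un_le[of "\<Union>p\<in>P. V p n" E] card_UN_le[OF P, of "\<lambda>p. V p n"] by linarith
    finally have "M * sep_count d f \<delta> x y n \<le> (\<Sum>p\<in>P. M * card (V p n)) + M * card E"
      by (metis distrib_left mult_le_mono2 sum_distrib_left)
    also have "(\<Sum>p\<in>P. M * card (V p n)) \<le> (\<Sum>p\<in>P. n + K p)" by (intro sum_mono K)
    finally show ?thesis by (simp add: sum.distrib)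
  qed
  have "\<not> points_separated d f \<delta> \<nu> x y"
  proof (rule not_points_separatedI)
    show "real (card P) / real M < \<nu>" using M by (simp add: field_simps)
    fix n
    have "real M * real (sep_count d f \<delta> x y n)
        \<le> real (card P) * real n + real ((\<Sum>p\<in>P. K p) + M * card E)"
      using count[of n] by (metis of_nat_add of_nat_le_iff of_nat_mult)
    then show "real (sep_count d f \<delta> x y n)
        \<le> real (card P) / real M * real n + real ((\<Sum>p\<in>P. K p) + M * card E) / real M"
      using M(1) by (simp add: field_simps)
  qed
  with xy show "\<exists>x\<in>S. \<exists>y\<in>S. x \<noteq> y \<and> \<not> points_separated d f \<delta> \<nu> x y" by blast
qed

lemma le_Sep_rotation_coordinate:
  fixes \<alpha> \<delta> p :: real and pt :: "real \<Rightarrow> 'a"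
  assumes \<alpha>: "\<alpha> \<notin> \<rat>" and "0 < q" "0 < M" "0 < \<delta>"
    and d: "\<And>x. d x x = 0" "\<And>x y. d x y = d y x"
    and pt: "\<And>s. pt s \<in> X"
    and cut: "\<And>s t k l. 0 \<le> s \<Longrightarrow> s < t \<Longrightarrow> t < 1 / real q \<Longrightarrow> s + real k * \<alpha> < p + of_int l \<Longrightarrow>
      p + of_int l < t + real k * \<alpha> \<Longrightarrow> d ((f ^^ k) (pt s)) ((f ^^ k) (pt t)) \<ge> \<delta>"
  shows "enat M \<le> Sep X d f \<delta> (1 / (real (q * M) + 1))"
proof -
  \<comment> \<open>Equally spaced coordinates in \<open>[0, 1/q)\<close>, distinct ones at least
    \<open>1 / (q * M)\<close> apart.\<close>
  define c where "c = (\<lambda>i::nat. real i / real (q * M))"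
  \<comment> \<open>The \<open>+ 1\<close> supplies the strict inequality that
    \<open>visits_lower\<close> asks for.\<close>
  define m where "m = q * M + 1"
  have "0 < m" by (simp add: m_def)
  have cq: "0 \<le> c i \<and> c i < 1 / real q" if "i < M" for i
    using that assms(2,3) by (auto simp: c_def field_simps)
  have sep: "\<exists>K. \<forall>n. n \<le> m * sep_count d f \<delta> (pt (c i)) (pt (c j)) n + K" if "i < j" "j < M" for i j
  proof -
    have less: "c i < c j" using that assms(2,3) by (auto simp: c_def divide_strict_right_mono)
    have "real 1 / real (q * M) \<le> real (j - i) / real (q * M)"
      using that by (intro divide_right_mono) auto
    also have "\<dots> = (p - c i) - (p - c j)" using that by (simp add: c_def of_nat_diff diff_divide_distrib)
    finally have "real m * (1 / real (q * M)) \<le> real m * ((p - c i) - (p - c j))"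
      by (intro mult_left_mono) auto
    moreover have "1 < real m * (1 / real (q * M))" using assms(2,3) by (simp add: m_def)
    ultimately have "1 < real m * ((p - c i) - (p - c j))" by linarith
    then obtain K where K: "\<And>n. n \<le> m * card {k. k < n \<and>
        (\<exists>l::int. p - c j < real k * \<alpha> + l \<and> real k * \<alpha> + l < p - c i)} + K"
      using visits_lower[OF \<alpha>, where m = m and a = "p - c j" and b = "p - c i"] \<open>0 < m\<close> by blast
    have "card {k. k < n \<and> (\<exists>l::int. p - c j < real k * \<alpha> + l \<and> real k * \<alpha> + l < p - c i)}
        \<le> sep_count d f \<delta> (pt (c i)) (pt (c j)) n" for n
      unfolding sep_count_def
    proof (rule card_mono)
      show "{k. k < n \<and> (\<exists>l::int. p - c j < real k * \<alpha> + l \<and> real k * \<alpha> + l < p - c i)}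
        \<subseteq> {k. k < n \<and> d ((f ^^ k) (pt (c i))) ((f ^^ k) (pt (c j))) \<ge> \<delta>}"
      proof clarify
        fix k and l :: int
        assume "p - c j < real k * \<alpha> + l" "real k * \<alpha> + l < p - c i"
        then show "d ((f ^^ k) (pt (c i))) ((f ^^ k) (pt (c j))) \<ge> \<delta>"
          using cut[of "c i" "c j" k "- l"] less cq[of i] cq[of j] that by auto
      qed
    qed simp
    then have "n \<le> m * sep_count d f \<delta> (pt (c i)) (pt (c j)) n + K" for n
      using K[of n] by (meson add_le_mono1 mult_le_mono2 order_trans)
    then show ?thesis by blast
  qed
  have psep: "points_separated d f \<delta> (1 / real m) (pt (c i)) (pt (c j))" if "i < j" "j < M" for i j
  proof -
    obtain K where K: "\<And>n. n \<le> m * sep_count d f \<delta> (pt (c i)) (pt (c j)) n + K"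
      using sep[OF \<open>i < j\<close> \<open>j < M\<close>] by blast
    show ?thesis
    proof (rule points_separatedI)
      fix n
      have "real n \<le> real m * real (sep_count d f \<delta> (pt (c i)) (pt (c j)) n) + real K"
        using K[of n] by (metis of_nat_add of_nat_le_iff of_nat_mult)
      then show "1 / real m * real n \<le> real (sep_count d f \<delta> (pt (c i)) (pt (c j)) n) + real K / real m"
        using \<open>0 < m\<close> by (simp add: field_simps)
    qed
  qed
  have sym: "points_separated d f \<delta> \<nu> x y \<longleftrightarrow> points_separated d f \<delta> \<nu> y x" for \<nu> x y
    unfolding points_separated_def sep_count_def by (simp add: d(2))
  have psep': "points_separated d f \<delta> (1 / real m) (pt (c i)) (pt (c j))"
    if "i \<noteq> j" "i < M" "j < M" for i j
    using psep[of i j] psep[of j i] sym that by (cases i j rule: linorder_cases) blast+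
  \<comment> \<open>No point is separated from itself, so the points \<open>pt (c i)\<close> are
    distinct and really \<open>M\<close> in number.\<close>
  have "\<not> points_separated d f \<delta> (1 / real m) x x" for x
    by (rule not_points_separated_if_finite) (use \<open>0 < \<delta>\<close> \<open>0 < m\<close> d(1) in \<open>auto simp: not_le\<close>)
  then have "inj_on (\<lambda>i. pt (c i)) {..<M}"
    using psep' unfolding inj_on_def by (metis lessThan_iff)
  then have "card ((\<lambda>i. pt (c i)) ` {..<M}) = M" by (simp add: card_image)
  moreover have "set_separated d f \<delta> (1 / real m) ((\<lambda>i. pt (c i)) ` {..<M})"
    unfolding set_separated_def by (auto intro!: psep')
  moreover have "(\<lambda>i. pt (c i)) ` {..<M} \<subseteq> X" using pt by auto
  moreover have "real m = real (q * M) + 1" by (simp add: m_def)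
  ultimately show ?thesis using card_le_Sep[of "(\<lambda>i. pt (c i)) ` {..<M}" X d f \<delta>] by simp
qed

section \<open>The circle and degree-one lifts\<close>

lemma to_circle_rep [simp]: "to_circle (circle_rep z) = z"
  by (rule Quotient_abs_rep[OF Quotient_circle])

lemma to_circle_eq_iff: "to_circle x = to_circle y \<longleftrightarrow> x - y \<in> \<int>"
  by (rule circle.abs_eq_iff)

lemma to_circle_add_int [simp]: "to_circle (x + of_int n) = to_circle x"
  by (simp add: to_circle_eq_iff)

lemma dist_to_circle: "dist (to_circle x) (to_circle y) = infdist (x - y) \<int>"
  by (rule dist_circle.abs_eq)

lemma dist_to_circle_le: "dist (to_circle x) (to_circle y) \<le> \<bar>x - y\<bar>"
  using infdist_le[of 0 "\<int>" "x - y"] by (simp add: dist_to_circle)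

text \<open>The bounds keep \<open>y - x\<close> at distance at least \<eta> from 0 and 1, hence
  from every integer: both arcs are long enough.\<close>

lemma dist_to_circle_ge:
  assumes "\<eta> \<le> y - x" "y - x \<le> 1 - \<eta>"
  shows "\<eta> \<le> dist (to_circle x) (to_circle y)"
proof -
  have "\<eta> \<le> dist (y - x) a" if a: "a \<in> \<int>" for a
  proof -
    obtain n :: int where n: "a = of_int n" using a by (rule Ints_cases)
    have "n \<le> 0 \<or> n \<ge> 1" by linarith
    then have "a \<le> 0 \<or> a \<ge> 1" unfolding n by (auto simp: of_int_le_0_iff)
    with assms show ?thesis by (auto simp: dist_real_def)
  qed
  moreover have "(\<int> :: real set) \<noteq> {}" using Ints_0 by blast
  ultimately have "\<eta> \<le> infdist (y - x) \<int>"
    by (auto simp: infdist_notempty intro!: cINF_greatest)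
  then show ?thesis by (metis dist_to_circle dist_commute)
qed

lemma dist_to_circle_lessE:
  assumes "dist (to_circle x) (to_circle y) < \<epsilon>"
  obtains n :: int where "\<bar>x - (y + of_int n)\<bar> < \<epsilon>"
proof -
  have "(\<int> :: real set) \<noteq> {}" using Ints_0 by blast
  then obtain a :: real where a: "a \<in> \<int>" "infdist (x - y) \<int> = dist (x - y) a"
    using infdist_attains_inf[OF closed_Ints] by metis
  obtain n :: int where "a = of_int n" using a(1) by (rule Ints_cases)
  with a(2) assms that show ?thesis
    by (simp add: dist_to_circle dist_real_def diff_diff_eq)
qed

lemma degree_one_add_int:
  fixes G :: "real \<Rightarrow> real"
  assumes "\<And>x. G (x + 1) = G x + 1"
  shows "G (x + of_int n) = G x + of_int n"
proof (induction n arbitrary: x rule: int_induct[where k = 0])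
  case (step1 i)
  have "G (x + of_int (i + 1)) = G (x + of_int i + 1)" by (simp add: add.assoc)
  then show ?case using step1(2) assms by simp
next
  case (step2 i)
  have "G (x + of_int i) = G (x + of_int (i - 1) + 1)" by (simp add: add.assoc)
  then show ?case using step2(2)[of x] assms[of "x + of_int (i - 1)"] by simp
qed simp

text \<open>The representative is arbitrary; for \<open>G\<close> of degree one the choice does not
  matter, by \<open>circle_map_to_circle\<close>.\<close>

definition circle_map :: "(real \<Rightarrow> real) \<Rightarrow> circle \<Rightarrow> circle" where
  "circle_map G z = to_circle (G (circle_rep z))"

lemma circle_map_to_circle:
  assumes "\<And>x. G (x + 1) = G x + 1"
  shows "circle_map G (to_circle x) = to_circle (G x)"
proof -
  have "circle_rep (to_circle x) - x \<in> \<int>" by (simp flip: to_circle_eq_iff)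
  then obtain n where "circle_rep (to_circle x) - x = of_int n" by (rule Ints_cases)
  then have "circle_rep (to_circle x) = x + of_int n" by simp
  then show ?thesis by (simp add: circle_map_def degree_one_add_int[of G, OF assms])
qed

lemma circle_map_continuous:
  assumes "continuous_on UNIV G" and deg: "\<And>x. G (x + 1) = G x + 1"
  shows "continuous_on UNIV (circle_map G)"
  unfolding continuous_on_iff
proof (intro ballI allI impI)
  fix z :: circle and e :: real assume "0 < e"
  define x where "x = circle_rep z"
  have z: "z = to_circle x" by (simp add: x_def)
  obtain d where d: "d > 0" "\<And>y. dist y x < d \<Longrightarrow> dist (G y) (G x) < e"
    using assms(1) \<open>0 < e\<close> unfolding continuous_on_iff by (metis UNIV_I)
  have "dist (circle_map G w) (circle_map G z) < e" if w: "dist w z < d" for w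
  proof -
    have "dist (to_circle x) (to_circle (circle_rep w)) < d"
      using w by (simp add: z dist_commute)
    then obtain n :: int where n: "\<bar>x - (circle_rep w + of_int n)\<bar> < d"
      using dist_to_circle_lessE by blast
    define y where "y = circle_rep w + of_int n"
    have "w = to_circle y" by (simp add: y_def)
    moreover have "dist y x < d" using n unfolding y_def dist_real_def by linarith
    then have "dist (G y) (G x) < e" by (rule d(2))
    ultimately show ?thesis
      using dist_to_circle_le[of "G y" "G x"]
      by (simp add: z circle_map_to_circle[of G, OF deg] dist_real_def)
  qed
  with d(1) show "\<exists>d>0. \<forall>w\<in>UNIV. dist w z < d \<longrightarrow> dist (circle_map G w) (circle_map G z) < e"
    by blast
qed

section \<open>Uniqueness and degree of lifts\<close>

lemma continuous_Ints_valued_constant: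
  fixes g :: "real \<Rightarrow> real"
  assumes "continuous_on UNIV g" "\<And>x. g x \<in> \<int>"
  obtains n :: int where "\<And>x. g x = of_int n"
proof -
  have "1 \<le> norm (g y - g x)" if "g y \<noteq> g x" for x y
    using Ints_nonzero_abs_ge1[of "g y - g x"] assms(2) that by simp
  then have "g constant_on UNIV"
    using assms(1) by (intro continuous_discrete_range_constant) (auto intro!: exI[of _ 1])
  then show ?thesis using that assms(2) by (metis Ints_cases UNIV_I constant_on_def)
qed

lemma is_lift_unique:
  assumes "is_lift F f" "is_lift G f"
  obtains n :: int where "\<And>x. G x = F x + of_int n"
proof -
  have "continuous_on UNIV (\<lambda>x. G x - F x)"
    using assms by (intro continuous_on_diff) (auto simp: is_lift_def)
  moreover have "G x - F x \<in> \<int>" for x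
    using assms by (simp add: is_lift_def flip: to_circle_eq_iff)
  ultimately obtain n :: int where "\<And>x. G x - F x = of_int n"
    using continuous_Ints_valued_constant by blast
  then show ?thesis using that[of n] by (simp add: diff_eq_eq add.commute)
qed

text \<open>Translating the argument by 1 gives another lift, which differs from \<open>F\<close> by
  an integer \<open>n\<close>. Monotonicity makes \<open>n\<close> positive; for
  \<open>n > 1\<close> the value \<open>F 0 + 1\<close> would be attained inside
  \<open>(0, 1)\<close>, against injectivity of \<open>f\<close>.\<close>

lemma is_lift_degree_one:
  assumes F: "is_lift F f" "strict_mono F" and "inj f"
  shows "F (x + 1) = F x + 1"
proof -
  have cont: "continuous_on UNIV F" and lift: "\<And>x. f (to_circle x) = to_circle (F x)"
    using F(1) by (auto simp: is_lift_def)
  have one: "to_circle (x + 1) = to_circle x" for x using to_circle_add_int[of x 1] by simp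
  have "is_lift (\<lambda>x. F (x + 1)) f"
    unfolding is_lift_def
  proof (intro conjI allI)
    show "continuous_on UNIV (\<lambda>x. F (x + 1))"
      by (intro continuous_on_compose2[OF cont] continuous_intros) auto
    show "f (to_circle x) = to_circle (F (x + 1))" for x using lift[of "x + 1"] one[of x] by simp
  qed
  then obtain n :: int where n: "\<And>x. F (x + 1) = F x + of_int n"
    using is_lift_unique[OF F(1)] by blast
  have "n > 0" using n[of 0] F(2) strict_monoD[of F 0 1] by simp
  moreover have "\<not> n > 1"
  proof
    assume "n > 1"
    then have "F 0 + 1 < F 1" using n[of 0] by simp
    moreover have "continuous_on {0..1} F" using cont continuous_on_subset by blast
    ultimately obtain y where y: "0 \<le> y" "y \<le> 1" "F y = F 0 + 1"
      using IVT'[of F 0 "F 0 + 1" 1] by auto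
    then have y': "0 < y" "y < 1" using \<open>F 0 + 1 < F 1\<close> by (auto simp: less_le)
    have "f (to_circle y) = f (to_circle 0)" using lift y(3) one by simp
    then have "y \<in> \<int>" using \<open>inj f\<close> to_circle_eq_iff[of y 0] by (simp add: inj_def)
    with y' show False by (auto elim!: Ints_cases)
  qed
  ultimately have "n = 1" by simp
  with n show ?thesis by simp
qed

text \<open>A monotone function can be discontinuous only by a jump, and a jump leaves a gap in the
  range.\<close>

lemma mono_dense_range_continuous:
  fixes H :: "real \<Rightarrow> real"
  assumes "mono H" and dense: "\<And>y \<epsilon>. \<epsilon> > 0 \<Longrightarrow> \<exists>x. \<bar>H x - y\<bar> < \<epsilon>"
  shows "continuous_on UNIV H"
  unfolding continuous_on_iff
proof (intro ballI allI impI)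
  fix x e :: real assume "0 < e"
  obtain a where a: "\<bar>H a - (H x - e / 2)\<bar> < e / 2" using dense[of "e / 2"] \<open>0 < e\<close> by auto
  obtain b where b: "\<bar>H b - (H x + e / 2)\<bar> < e / 2" using dense[of "e / 2"] \<open>0 < e\<close> by auto
  have ab: "H x - e < H a" "H a < H x" "H x < H b" "H b < H x + e" using a b by linarith+
  then have "a < x" "x < b" using monoD[OF \<open>mono H\<close>] by (meson not_le)+
  have "dist (H y) (H x) < e" if "dist y x < min (x - a) (b - x)" for y
  proof -
    have "a \<le> y" "y \<le> b" using that by (auto simp: dist_real_def)
    then have "H a \<le> H y" "H y \<le> H b" using monoD[OF \<open>mono H\<close>] by auto
    with ab show ?thesis by (simp add: dist_real_def abs_less_iff)
  qed
  then show "\<exists>d>0. \<forall>y\<in>UNIV. dist y x < d \<longrightarrow> dist (H y) (H x) < e"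
    using \<open>a < x\<close> \<open>x < b\<close> by (intro exI[of _ "min (x - a) (b - x)"]) auto
qed

section \<open>Semiconjugacy to the rotation and Denjoy homeomorphisms\<close>

locale irrational_circle_lift =
  fixes F :: "real \<Rightarrow> real" and \<alpha> :: real
  assumes F_strict_mono: "strict_mono F"
    and F_add_1: "F (x + 1) = F x + 1"
    and irrational: "\<alpha> \<notin> \<rat>"
    and rotation_number: "(\<lambda>n. ((F ^^ n) x - x) / real n) \<longlonglongrightarrow> \<alpha>"
begin

lemma funpow_add_1: "(F ^^ n) (x + 1) = (F ^^ n) x + 1"
  by (induction n) (simp_all add: F_add_1)

lemma funpow_add_int: "(F ^^ n) (x + of_int l) = (F ^^ n) x + of_int l"
  by (rule degree_one_add_int) (rule funpow_add_1)

lemma funpow_strict_mono: "strict_mono (F ^^ n)"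
proof (induction n)
  case (Suc n)
  from strict_mono_o[OF F_strict_mono this] show ?case by (simp add: o_def)
qed (simp add: strict_mono_def)

text \<open>An integer translate of \<open>y\<close> satisfies
  \<open>y + m \<le> x \<le> y + m + 1\<close>; the increasing map \<open>F ^^ n\<close> preserves
  this order and commutes with integer translations.\<close>

lemma displacement_diff_le: "\<bar>((F ^^ n) x - x) - ((F ^^ n) y - y)\<bar> \<le> 1"
proof -
  define m where "m = \<lfloor>x - y\<rfloor>"
  have m: "y + of_int m \<le> x" "x \<le> y + of_int m + 1" unfolding m_def by linarith+
  have "mono (F ^^ n)" by (rule strict_mono_mono[OF funpow_strict_mono])
  from monoD[OF this m(1)] monoD[OF this m(2)] m
  show ?thesis unfolding funpow_add_1 funpow_add_int by linarith
qed

text \<open>Each step of \<open>G = F ^^ n\<close> moves a point by \<open>u\<close> up to an error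
  of 1, so the mean displacement over \<open>k\<close> steps is within 1 of \<open>u\<close>; as
  \<open>k\<close> grows it tends to \<open>n * \<alpha>\<close>.\<close>

lemma displacement_bounded: "\<bar>(F ^^ n) x - x - real n * \<alpha>\<bar> \<le> 1"
proof (cases "n = 0")
  case False
  define G where "G = F ^^ n"
  define u where "u = G x - x"
  have G: "G ^^ k = F ^^ (k * n)" for k by (simp add: G_def funpow_mult mult.commute)
  have step: "\<bar>(G ^^ k) x - x - real k * u\<bar> \<le> real k" for k
  proof (induction k)
    case (Suc k)
    have "\<bar>(G ((G ^^ k) x) - (G ^^ k) x) - u\<bar> \<le> 1"
      unfolding u_def G_def by (rule displacement_diff_le)
    with Suc show ?case by (simp add: distrib_right)
  qed simp
  have "strict_mono (\<lambda>k. Suc k * n)" using False by (auto intro!: strict_monoI)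
  from LIMSEQ_subseq_LIMSEQ[OF rotation_number this]
  have "(\<lambda>k. real n * (((G ^^ Suc k) x - x) / real (Suc k * n))) \<longlonglongrightarrow> real n * \<alpha>"
    unfolding G by (intro tendsto_mult_left) (simp add: o_def)
  moreover have "real n * (((G ^^ Suc k) x - x) / real (Suc k * n)) = ((G ^^ Suc k) x - x) / real (Suc k)" for k
    using False by (simp del: funpow.simps mult_Suc of_nat_Suc)
  ultimately have lim: "(\<lambda>k. ((G ^^ Suc k) x - x) / real (Suc k)) \<longlonglongrightarrow> real n * \<alpha>" by simp
  have "\<bar>u - ((G ^^ Suc k) x - x) / real (Suc k)\<bar> \<le> 1" for k
  proof -
    have "u - ((G ^^ Suc k) x - x) / real (Suc k) = - (((G ^^ Suc k) x - x - real (Suc k) * u) / real (Suc k))"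
      by (simp add: field_simps del: funpow.simps)
    moreover have "\<bar>((G ^^ Suc k) x - x - real (Suc k) * u) / real (Suc k)\<bar> \<le> 1"
      using step[of "Suc k"] by (simp del: funpow.simps of_nat_Suc)
    ultimately show ?thesis by (metis abs_minus_cancel)
  qed
  moreover have "(\<lambda>k. \<bar>u - ((G ^^ Suc k) x - x) / real (Suc k)\<bar>) \<longlonglongrightarrow> \<bar>u - real n * \<alpha>\<bar>"
    by (intro tendsto_intros lim)
  ultimately have "\<bar>u - real n * \<alpha>\<bar> \<le> 1" by (intro LIMSEQ_le_const2) auto
  then show ?thesis by (simp add: u_def G_def)
qed simp

text \<open>A limsup needs no convergence, is monotone in \<open>x\<close> and respects constant
  shifts. By \<open>displacement_bounded\<close> it is finite, so \<open>real_of_ereal\<close> loses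
  nothing.\<close>

definition H :: "real \<Rightarrow> real" where
  "H x = real_of_ereal (limsup (\<lambda>n. ereal ((F ^^ n) x - real n * \<alpha>)))"

lemma
  shows H_limsup: "ereal (H x) = limsup (\<lambda>n. ereal ((F ^^ n) x - real n * \<alpha>))" (is "_ = ?L")
    and H_le: "H x \<le> x + 1" and H_ge: "x - 1 \<le> H x"
proof -
  have b: "x - 1 \<le> (F ^^ n) x - real n * \<alpha>" "(F ^^ n) x - real n * \<alpha> \<le> x + 1" for n
    using displacement_bounded[of n x] by linarith+
  have "?L \<le> ereal (x + 1)"
    by (rule Limsup_bounded) (use b(2) in \<open>auto intro!: always_eventually\<close>)
  moreover have "ereal (x - 1) \<le> ?L"
  proof -
    have "ereal (x - 1) \<le> liminf (\<lambda>n. ereal ((F ^^ n) x - real n * \<alpha>))"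
      by (rule Liminf_bounded) (use b(1) in \<open>auto intro!: always_eventually\<close>)
    then show ?thesis using Liminf_le_Limsup[of sequentially] by (meson order_trans sequentially_bot)
  qed
  moreover from calculation show "ereal (H x) = ?L"
    unfolding H_def by (cases ?L) auto
  ultimately show "H x \<le> x + 1" "x - 1 \<le> H x" by (metis ereal_less_eq(3))+
qed

lemma H_mono: "mono H"
proof (rule monoI)
  fix x y :: real assume "x \<le> y"
  have "ereal (H x) \<le> ereal (H y)"
    unfolding H_limsup using monoD[OF strict_mono_mono[OF funpow_strict_mono] \<open>x \<le> y\<close>]
    by (intro Limsup_mono always_eventually) simp
  then show "H x \<le> H y" by simp
qed

lemma H_add_1: "H (x + 1) = H x + 1"
proof -
  have "ereal (H (x + 1)) = limsup (\<lambda>n. ereal ((F ^^ n) x - real n * \<alpha>) + 1)"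
    unfolding H_limsup funpow_add_1 by (simp add: one_ereal_def algebra_simps)
  also have "\<dots> = ereal (H x) + 1"
    unfolding H_limsup by (rule Limsup_add_ereal_right) auto
  finally show ?thesis by (simp add: one_ereal_def)
qed

text \<open>Dropping the first term does not change a limsup, and the index shift costs exactly one
  \<alpha>.\<close>

lemma H_F: "H (F x) = H x + \<alpha>"
proof -
  have "ereal (H (F x)) = limsup (\<lambda>n. ereal ((F ^^ Suc n) x - real (Suc n) * \<alpha>) + ereal \<alpha>)"
    unfolding H_limsup by (simp add: algebra_simps flip: funpow_swap1)
  also have "\<dots> = limsup (\<lambda>n. ereal ((F ^^ Suc n) x - real (Suc n) * \<alpha>)) + ereal \<alpha>"
    by (rule Limsup_add_ereal_right) auto
  also have "\<dots> = ereal (H x) + ereal \<alpha>"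
    unfolding H_limsup using limsup_shift[of "\<lambda>n. ereal ((F ^^ n) x - real n * \<alpha>)"]
    by (simp del: funpow.simps)
  finally show ?thesis by simp
qed

lemma H_add_int: "H (x + of_int l) = H x + of_int l"
  by (rule degree_one_add_int) (rule H_add_1)

lemma H_funpow: "H ((F ^^ k) x) = H x + real k * \<alpha>"
  by (induction k) (simp_all add: H_F algebra_simps)

text \<open>The range of \<open>H\<close> contains all \<open>H 0 + j * \<alpha> + l\<close>, a
  dense set, and \<open>H\<close> is monotone.\<close>

lemma H_continuous: "continuous_on UNIV H"
proof (rule mono_dense_range_continuous[OF H_mono])
  fix y \<epsilon> :: real assume "\<epsilon> > 0"
  obtain j :: nat and l :: int where jl: "\<bar>real j * \<alpha> + of_int l - (y - H 0)\<bar> < \<epsilon>"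
    using irrational_orbit_dense[OF irrational \<open>\<epsilon> > 0\<close>] by blast
  have "H ((F ^^ j) 0 + of_int l) - y = real j * \<alpha> + of_int l - (y - H 0)"
    by (simp add: H_add_int H_funpow)
  with jl show "\<exists>x. \<bar>H x - y\<bar> < \<epsilon>" by metis
qed

lemma H_surj: "surj H"
proof -
  have "\<exists>x. H x = y" for y
    using IVT'[of H "y - 1" y "y + 1"] H_le[of "y - 1"] H_ge[of "y + 1"]
      continuous_on_subset[OF H_continuous] by auto
  then show ?thesis by (metis surjI)
qed

text \<open>Integer translations reduce this to the compact interval \<open>[-1, 2]\<close>: they
  bring \<open>x\<close> into \<open>[0, 1)\<close>, and \<open>y\<close> is less than 1
  away.\<close>

lemma H_uniformly_continuous:
  assumes "\<epsilon> > 0"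
  obtains \<eta> where "\<eta> > 0" "\<And>x y. \<bar>x - y\<bar> < \<eta> \<Longrightarrow> \<bar>H x - H y\<bar> < \<epsilon>"
proof -
  have "uniformly_continuous_on {-1..2} H"
    using continuous_on_subset[OF H_continuous] by (intro compact_uniformly_continuous) auto
  then obtain e where e: "e > 0"
    "\<And>x y. x \<in> {-1..2} \<Longrightarrow> y \<in> {-1..2} \<Longrightarrow> dist x y < e \<Longrightarrow> dist (H x) (H y) < \<epsilon>"
    unfolding uniformly_continuous_on_def using assms by metis
  have "\<bar>H x - H y\<bar> < \<epsilon>" if "\<bar>x - y\<bar> < min e 1" for x y
  proof -
    define n where "n = - \<lfloor>x\<rfloor>"
    have "0 \<le> x + of_int n" "x + of_int n < 1" by (auto simp: n_def) linarith
    then have "x + of_int n \<in> {-1..2}" "y + of_int n \<in> {-1..2}" using that by auto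
    from e(2)[OF this] that show ?thesis by (simp add: H_add_int dist_real_def)
  qed
  with e(1) that[of "min e 1"] show ?thesis by simp
qed

text \<open>The inverse of \<open>H\<close> is monotone and onto, hence continuous by the same
  density argument; both maps have degree one and descend to the circle. Used contrapositively, this
  provides the plateau of \<open>H\<close> for Denjoy maps.\<close>

lemma strict_mono_H_imp_conjugate:
  assumes lift: "\<And>x. f (to_circle x) = to_circle (F x)" and "strict_mono H"
  shows "topologically_conjugate f (rotation \<alpha>)"
proof -
  define K where "K = inv H"
  have HK: "H (K y) = y" for y unfolding K_def by (rule surj_f_inv_f[OF H_surj])
  have KH: "K (H x) = x" for x
    unfolding K_def using strict_mono_imp_inj_on[OF assms(2)] by simp
  have "mono K"
  proof (rule monoI)
    fix x y :: real assume "x \<le> y"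
    then show "K x \<le> K y" using strict_mono_less_eq[OF assms(2), of "K x" "K y"] HK by simp
  qed
  moreover have "\<exists>x. \<bar>K x - y\<bar> < \<epsilon>" if "\<epsilon> > 0" for y \<epsilon> using KH[of y] that by (intro exI[of _ "H y"]) simp
  ultimately have contK: "continuous_on UNIV K" by (rule mono_dense_range_continuous)
  have K1: "K (y + 1) = K y + 1" for y using KH[of "K y + 1"] H_add_1[of "K y"] HK by simp
  note cm = circle_map_to_circle[of H, OF H_add_1] circle_map_to_circle[of K, OF K1]
  have "homeomorphism UNIV UNIV (circle_map H) (circle_map K)"
  proof (rule homeomorphismI)
    show "continuous_on UNIV (circle_map H)"
      by (rule circle_map_continuous[OF H_continuous H_add_1])
    show "continuous_on UNIV (circle_map K)" by (rule circle_map_continuous[OF contK K1])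
    show "circle_map K (circle_map H z) = z" "circle_map H (circle_map K z) = z" for z
      using cm HK KH to_circle_rep by metis+
  qed auto
  moreover have "circle_map H (f z) = rotation \<alpha> (circle_map H z)" for z
    using lift[of "circle_rep z"] cm(1) H_F by (metis rotation.abs_eq to_circle_rep)
  ultimately show ?thesis unfolding topologically_conjugate_def by (auto simp: fun_eq_iff)
qed

lemma lift_funpow:
  assumes "\<And>x. f (to_circle x) = to_circle (F x)"
  shows "(f ^^ k) (to_circle x) = to_circle ((F ^^ k) x)"
  by (induction k) (simp_all add: assms)

text \<open>Between lifted points at least \<delta> apart lies a point of the mesh of width
  \<open>1 / r\<close>; its image under the monotone \<open>H\<close> is a cut point between the
  coordinates. Thus \<open>P\<close> consists of the images of the mesh in one period.\<close>

lemma Sep_le: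
  assumes lift: "\<And>x. f (to_circle x) = to_circle (F x)" and "\<delta> > 0"
  shows "\<exists>r. \<forall>M \<nu>. 0 < M \<and> 0 < \<nu> \<and> r < real M * \<nu> \<longrightarrow> Sep UNIV dist f \<delta> \<nu> \<le> enat M"
proof -
  obtain r :: nat where r: "0 < r" "1 / real r < \<delta>"
    using \<open>\<delta> > 0\<close> by (metis inverse_eq_divide real_arch_inverse neq0_conv)
  define P where "P = (\<lambda>i. H (real i / real r)) ` {..<r}"
  \<comment> \<open>The representative is normalised by its coordinate: \<open>H (lft z)\<close>,
    not \<open>lft z\<close>, lies in \<open>[0, 1)\<close>.\<close>
  define lft where "lft z = circle_rep z + of_int (- \<lfloor>H (circle_rep z)\<rfloor>)" for z
  have lft: "to_circle (lft z) = z" for z unfolding lft_def by (simp del: of_int_minus)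
  have H_lft: "0 \<le> H (lft z) \<and> H (lft z) < 1" for z
    unfolding lft_def H_add_int by simp linarith
  have mesh: "\<exists>p\<in>P. \<exists>l::int. H x \<le> p + of_int l \<and> p + of_int l \<le> H y" if "x + \<delta> \<le> y" for x y
  proof -
    define j where "j = \<lceil>x * real r\<rceil>"
    have "x * real r \<le> of_int j" "of_int j < x * real r + 1" unfolding j_def by linarith+
    then have j: "x \<le> of_int j / real r" "of_int j / real r \<le> x + 1 / real r"
      using r(1) by (simp_all add: field_simps)
    define i where "i = nat (j mod int r)"
    have i: "i < r" "int i = j mod int r" using r(1) by (auto simp: i_def nat_less_iff)
    have "real_of_int j = of_int (int r * (j div int r) + int i)" unfolding i(2) by simp
    then have "of_int j / real r = real i / real r + of_int (j div int r)"
      using r(1) by (simp add: field_simps)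
    then have "H (of_int j / real r) = H (real i / real r) + of_int (j div int r)"
      by (simp only: H_add_int)
    moreover have "H x \<le> H (of_int j / real r)" "H (of_int j / real r) \<le> H y"
      using j r(2) that by (auto intro!: monoD[OF H_mono])
    ultimately show ?thesis using i(1) unfolding P_def by auto
  qed
  have cut: "\<exists>p\<in>P. \<exists>l::int. min (H (lft z)) (H (lft w)) + real k * \<alpha> \<le> p + l
        \<and> p + l \<le> max (H (lft z)) (H (lft w)) + real k * \<alpha>"
    if d: "dist ((f ^^ k) z) ((f ^^ k) w) \<ge> \<delta>" for k z w
  proof -
    define x y where "x = (F ^^ k) (lft z)" and "y = (F ^^ k) (lft w)"
    have "(f ^^ k) z = to_circle x" "(f ^^ k) w = to_circle y"
      using lift_funpow[OF lift] lft unfolding x_def y_def by metis+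
    with d dist_to_circle_le[of x y] have "\<bar>x - y\<bar> \<ge> \<delta>" by simp
    then have "x + \<delta> \<le> y \<or> y + \<delta> \<le> x" by linarith
    moreover have "H x = H (lft z) + real k * \<alpha>" "H y = H (lft w) + real k * \<alpha>"
      by (simp_all add: x_def y_def H_funpow)
    ultimately obtain p and l :: int where "p \<in> P"
      "min (H x) (H y) \<le> p + l \<and> p + l \<le> max (H x) (H y)"
      using mesh[of x y] mesh[of y x] by (metis max.coboundedI1 max.coboundedI2 min.coboundedI1 min.coboundedI2)
    then show ?thesis unfolding \<open>H x = _\<close> \<open>H y = _\<close> min_add_distrib_left max_add_distrib_left by blast
  qed
  have "Sep UNIV dist f \<delta> \<nu> \<le> enat M" if "0 < M" "0 < \<nu>" "real (card P) < real M * \<nu>" for M \<nu>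
  proof (rule Sep_le_rotation_coordinate[OF irrational _ that, where g = "\<lambda>z. H (lft z)"])
    show "finite P" by (simp add: P_def)
    fix z w :: circle
    have "{k. dist ((f ^^ k) z) ((f ^^ k) w) \<ge> \<delta> \<and>
      \<not> (\<exists>p\<in>P. \<exists>l::int. min (H (lft z)) (H (lft w)) + real k * \<alpha> \<le> p + l
        \<and> p + l \<le> max (H (lft z)) (H (lft w)) + real k * \<alpha>)} = {}"
      using cut by blast
    then show "finite {k. dist ((f ^^ k) z) ((f ^^ k) w) \<ge> \<delta> \<and>
      \<not> (\<exists>p\<in>P. \<exists>l::int. min (H (lft z)) (H (lft w)) + real k * \<alpha> \<le> p + l
        \<and> p + l \<le> max (H (lft z)) (H (lft w)) + real k * \<alpha>)}" by (metis finite.emptyI)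
  qed (rule H_lft)
  then show ?thesis by blast
qed

text \<open>A plateau \<open>[u, v]\<close> of the semiconjugacy lifts a wandering interval. Two points on different
  sides of it are far apart along one arc by the length of the interval, and along the other one because
  their images under the semiconjugacy are.\<close>
lemma le_Sep:
  assumes lift: "\<And>x. f (to_circle x) = to_circle (F x)" and gap: "u < v" "H u = H v"
  shows "\<exists>\<delta>>0. \<forall>M>0. enat M \<le> Sep UNIV dist f \<delta> (1 / (real (2 * M) + 1))"
proof -
  obtain \<eta> where \<eta>: "\<eta> > 0" "\<And>x y. \<bar>x - y\<bar> < \<eta> \<Longrightarrow> \<bar>H x - H y\<bar> < 1 / 2"
    using H_uniformly_continuous[of "1 / 2"] by auto
  define \<delta> where "\<delta> = min (v - u) \<eta>"
  have "\<delta> > 0" using gap \<eta> by (simp add: \<delta>_def)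
  define pt where "pt s = to_circle (inv H s)" for s
  have Hinv: "H (inv H s) = s" for s by (rule surj_f_inv_f[OF H_surj])
  have less: "x < y" if "H x < H y" for x y using monoD[OF H_mono, of y x] that by (meson not_le)
  \<comment> \<open>The cut point \<open>H u\<close> is the value on the plateau, and the parameter
    2 confines the coordinates to \<open>[0, 1/2)\<close>.\<close>
  have "enat M \<le> Sep UNIV dist f \<delta> (1 / (real (2 * M) + 1))" if "M > 0" for M
  proof (rule le_Sep_rotation_coordinate[OF irrational _ that \<open>\<delta> > 0\<close>, where pt = pt and p = "H u"])
    fix s t k l
    assume st: "0 \<le> s" "s < t" "t < 1 / real 2"
      and cut: "s + real k * \<alpha> < H u + of_int l" "H u + of_int l < t + real k * \<alpha>"
    define x y where "x = (F ^^ k) (inv H s)" and "y = (F ^^ k) (inv H t)"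
    have H: "H x = s + real k * \<alpha>" "H y = t + real k * \<alpha>" by (simp_all add: x_def y_def H_funpow Hinv)
    have "x < u + of_int l" using cut(1) by (simp add: less H H_add_int)
    moreover have "v + of_int l < y" using cut(2) gap(2) by (simp add: less H H_add_int)
    ultimately have "\<delta> \<le> y - x" by (simp add: \<delta>_def)
    \<comment> \<open>Coordinates differ by less than 1/2, so the complementary arc from
      \<open>y\<close> to \<open>x + 1\<close> has \<open>H\<close>-length above 1/2 and thus length
      at least \<eta>.\<close>
    have "H y < H (x + 1)" "1 / 2 < H (x + 1) - H y" using st by (simp_all add: H H_add_1)
    then have "y < x + 1" "\<not> \<bar>(x + 1) - y\<bar> < \<eta>" using less \<eta>(2)[of "x + 1" y] by auto
    then have "y - x \<le> 1 - \<delta>" by (simp add: \<delta>_def)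
    with \<open>\<delta> \<le> y - x\<close> have "\<delta> \<le> dist (to_circle x) (to_circle y)" by (intro dist_to_circle_ge)
    then show "\<delta> \<le> dist ((f ^^ k) (pt s)) ((f ^^ k) (pt t))"
      by (simp add: pt_def lift_funpow[OF lift] x_def y_def)
  qed (simp_all add: dist_commute)
  with \<open>\<delta> > 0\<close> show ?thesis by blast
qed

end

theorem has_ac_denjoy:
  assumes "denjoy_homeomorphism f"
  shows "has_ac UNIV dist f 1"
proof -
  obtain \<alpha> g F G where \<alpha>: "\<alpha> \<notin> \<rat>" "\<not> topologically_conjugate f (rotation \<alpha>)"
    and g: "homeomorphism UNIV UNIV f g" and F: "is_lift F f" "strict_mono F"
    and G: "is_lift G f" "\<And>x. (\<lambda>n. ((G ^^ n) x - x) / real n) \<longlonglongrightarrow> \<alpha>"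
    using assms unfolding denjoy_homeomorphism_def orientation_preserving_homeomorphism_def
      has_rotation_number_def by blast
  \<comment> \<open>The lift \<open>G\<close> witnessing the rotation number need not be the
    increasing lift \<open>F\<close>, but an integer translate of \<open>F\<close> is increasing
    too.\<close>
  obtain n :: int where n: "\<And>x. G x = F x + of_int n" using is_lift_unique[OF F(1) G(1)] by blast
  have sG: "strict_mono G" using F(2) by (simp add: strict_mono_def n)
  have "inj f" using g by (auto simp: homeomorphism_def inj_def) metis
  interpret irrational_circle_lift G \<alpha>
    by unfold_locales (use sG is_lift_degree_one[OF G(1) sG \<open>inj f\<close>] \<alpha>(1) G(2) in auto)
  have lift: "f (to_circle x) = to_circle (G x)" for x using G(1) by (simp add: is_lift_def)
  have "\<not> strict_mono H" using strict_mono_H_imp_conjugate[OF lift] \<alpha>(2) by blast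
  then obtain u v where "u < v" "\<not> H u < H v" by (auto simp: strict_mono_def)
  then have "H u = H v" using monoD[OF H_mono, of u v] by simp
  from le_Sep[OF lift \<open>u < v\<close> this] obtain \<delta> where
    "\<delta> > 0" "\<And>M. M > 0 \<Longrightarrow> enat M \<le> Sep UNIV dist f \<delta> (1 / (real (2 * M) + 1))" by blast
  from has_ac_oneI[OF Sep_le[OF lift] this(1) _ this(2)] show ?thesis by simp
qed

section \<open>Sturmian subshifts\<close>

lemma rotation_to_circle: "rotation \<alpha> (to_circle x) = to_circle (x + \<alpha>)"
  by (rule rotation.abs_eq)

lemma inv_rotation: "inv (rotation \<alpha>) = rotation (- \<alpha>)"
proof (rule inv_equality)
  show "rotation (- \<alpha>) (rotation \<alpha> z) = z" "rotation \<alpha> (rotation (- \<alpha>) z) = z" for z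
    using rotation_to_circle[of _ "circle_rep z"] by (simp_all add: rotation_to_circle)
qed

lemma funpow_rotation: "(rotation \<alpha> ^^ n) (to_circle x) = to_circle (x + real n * \<alpha>)"
  by (induction n) (simp_all add: rotation_to_circle algebra_simps)

lemma int_iterate_rotation: "int_iterate (rotation \<alpha>) k (to_circle x) = to_circle (x + of_int k * \<alpha>)"
  by (simp add: int_iterate_def inv_rotation funpow_rotation)

section \<open>The coding as a function on the line, and its cut points\<close>

definition coding :: "real \<Rightarrow> real \<Rightarrow> bit" where
  "coding \<alpha> y = (if frac y < 1 - \<alpha> then 0 else 1)"

lemma coding_add_int [simp]: "coding \<alpha> (y + of_int n) = coding \<alpha> y"
  by (simp add: coding_def frac_def)

lemma sturmian_sequence_to_circle: "sturmian_sequence \<alpha> (to_circle x) k = coding \<alpha> (x + of_int k * \<alpha>)"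
  by (simp add: sturmian_sequence_def int_iterate_rotation sturmian_coding.abs_eq coding_def)

text \<open>If no integer lies in \<open>(u, v]\<close>, both floors agree, so the coding can only
  change from 0 to 1, across an integer minus \<alpha>.\<close>

lemma coding_neq_imp_cut:
  assumes "u \<le> v" "coding \<alpha> u \<noteq> coding \<alpha> v"
  shows "\<exists>l::int. u \<le> l \<and> l \<le> v \<or> u \<le> l - \<alpha> \<and> l - \<alpha> \<le> v"
proof (cases "of_int (\<lfloor>u\<rfloor> + 1) \<le> v")
  case True
  then show ?thesis by (intro exI[of _ "\<lfloor>u\<rfloor> + 1"]) linarith
next
  case False
  then have "\<lfloor>v\<rfloor> = \<lfloor>u\<rfloor>" using assms(1) by linarith
  then have "frac u < 1 - \<alpha>" "\<not> frac v < 1 - \<alpha>"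
    using assms by (auto simp: coding_def frac_def split: if_splits)
  then have "u \<le> of_int (\<lfloor>u\<rfloor> + 1) - \<alpha>" "of_int (\<lfloor>u\<rfloor> + 1) - \<alpha> \<le> v"
    using \<open>\<lfloor>v\<rfloor> = \<lfloor>u\<rfloor>\<close> by (auto simp: frac_def)
  then show ?thesis by blast
qed

text \<open>The length bounds keep \<open>u\<close> in the piece \<open>[l - \<alpha>, l)\<close>,
  coded 1, and \<open>v\<close> in \<open>[l, l + 1 - \<alpha>)\<close>, coded 0.\<close>

lemma coding_across_int:
  assumes "u < of_int l" "of_int l < v" "v - u \<le> \<alpha>" "v - u \<le> 1 - \<alpha>" "0 < \<alpha>" "\<alpha> < 1"
  shows "coding \<alpha> u \<noteq> coding \<alpha> v"
proof -
  have "\<lfloor>u\<rfloor> = l - 1" "\<lfloor>v\<rfloor> = l" using assms by linarith+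
  then have "\<not> frac u < 1 - \<alpha>" "frac v < 1 - \<alpha>" using assms by (auto simp: frac_def)
  then show ?thesis by (simp add: coding_def)
qed

lemma coding_locally_constant:
  assumes "y \<notin> \<int>" "y + \<alpha> \<notin> \<int>"
  shows "\<exists>e>0. \<forall>y'. \<bar>y' - y\<bar> < e \<longrightarrow> coding \<alpha> y' = coding \<alpha> y"
proof -
  define e where "e = min (infdist y \<int>) (infdist (y + \<alpha>) \<int>)"
  have ne: "(\<int> :: real set) \<noteq> {}" using Ints_0 by blast
  have "0 < infdist y \<int>" "0 < infdist (y + \<alpha>) \<int>"
    using assms in_closed_iff_infdist_zero[OF closed_Ints ne] infdist_nonneg by (metis less_le)+
  then have "e > 0" by (simp add: e_def)
  moreover have "coding \<alpha> y' = coding \<alpha> y" if y': "\<bar>y' - y\<bar> < e" for y'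
  proof (rule ccontr)
    assume ne: "coding \<alpha> y' \<noteq> coding \<alpha> y"
    have "\<exists>l::int. \<bar>y - l\<bar> \<le> \<bar>y' - y\<bar> \<or> \<bar>y + \<alpha> - l\<bar> \<le> \<bar>y' - y\<bar>"
    proof (cases "y \<le> y'")
      case True
      with coding_neq_imp_cut[of y y' \<alpha>] ne obtain l :: int where
        "y \<le> l \<and> l \<le> y' \<or> y \<le> l - \<alpha> \<and> l - \<alpha> \<le> y'" by metis
      then show ?thesis by (intro exI[of _ l]) linarith
    next
      case False
      with coding_neq_imp_cut[of y' y \<alpha>] ne obtain l :: int where
        "y' \<le> l \<and> l \<le> y \<or> y' \<le> l - \<alpha> \<and> l - \<alpha> \<le> y" by fastforce
      then show ?thesis by (intro exI[of _ l]) linarith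
    qed
    then obtain l :: int where "\<bar>y - l\<bar> \<le> \<bar>y' - y\<bar> \<or> \<bar>y + \<alpha> - l\<bar> \<le> \<bar>y' - y\<bar>" by blast
    moreover have "infdist y \<int> \<le> \<bar>y - l\<bar>" "infdist (y + \<alpha>) \<int> \<le> \<bar>y + \<alpha> - l\<bar>"
      using infdist_le[of "real_of_int l" \<int>] by (simp_all add: dist_real_def)
    ultimately show False using y' by (auto simp: e_def)
  qed
  ultimately show ?thesis by blast
qed

lemma shift_dist_ge:
  assumes "x k \<noteq> y k"
  shows "1 / 2 ^ nat \<bar>k\<bar> \<le> shift_dist x y"
proof -
  let ?L = "LEAST j. \<exists>k. j = nat \<bar>k\<bar> \<and> x k \<noteq> y k"
  have "?L \<le> nat \<bar>k\<bar>" using assms by (intro Least_le) blast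
  then have "(2 :: real) ^ ?L \<le> 2 ^ nat \<bar>k\<bar>" by (rule power_increasing) simp
  moreover have "x \<noteq> y" using assms by blast
  ultimately show ?thesis by (simp add: shift_dist_def frac_le)
qed

lemma shift_dist_gtE:
  assumes "1 / 2 ^ m < shift_dist x y"
  obtains j where "\<bar>j\<bar> \<le> int m" "x j \<noteq> y j"
proof -
  let ?L = "LEAST j. \<exists>k. j = nat \<bar>k\<bar> \<and> x k \<noteq> y k"
  have "x \<noteq> y" using assms by (auto simp: shift_dist_def)
  then obtain k0 where "x k0 \<noteq> y k0" by blast
  then have "\<exists>k. ?L = nat \<bar>k\<bar> \<and> x k \<noteq> y k"
    by (intro LeastI[of "\<lambda>j. \<exists>k. j = nat \<bar>k\<bar> \<and> x k \<noteq> y k" "nat \<bar>k0\<bar>"]) blast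
  then obtain k where k: "?L = nat \<bar>k\<bar>" "x k \<noteq> y k" by blast
  have "(1::real) / 2 ^ m < 1 / 2 ^ ?L" using assms \<open>x \<noteq> y\<close> by (simp add: shift_dist_def)
  then have "(2::real) ^ ?L < 2 ^ m" by (simp add: field_simps)
  then have "?L < m" by simp
  with k that[of k] show ?thesis by linarith
qed

lemma funpow_left_shift: "(left_shift ^^ n) x = (\<lambda>k. x (k + int n))"
  by (induction n) (simp_all add: left_shift_def algebra_simps)

text \<open>There is at most one such \<open>k\<close>: two of them would make a nonzero integer
  multiple of \<alpha> rational.\<close>

lemma finite_irrational_orbit_Ints:
  fixes \<alpha> t :: real
  assumes "\<alpha> \<notin> \<rat>"
  shows "finite {k::int. t + of_int k * \<alpha> \<in> \<int>}"
proof -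
  have "k = k'" if k: "t + of_int k * \<alpha> \<in> \<int>" "t + of_int k' * \<alpha> \<in> \<int>" for k k' :: int
  proof (rule ccontr)
    assume "k \<noteq> k'"
    have "(t + of_int k * \<alpha>) - (t + of_int k' * \<alpha>) \<in> \<rat>"
      using Ints_diff[OF k] Ints_subset_Rats by blast
    then have "of_int (k - k') * \<alpha> \<in> \<rat>" by (simp add: algebra_simps)
    then have "of_int (k - k') * \<alpha> / of_int (k - k') \<in> \<rat>" by (intro Rats_divide) auto
    with \<open>k \<noteq> k'\<close> assms show False by simp
  qed
  then show ?thesis by (auto intro: finite_subset[where B = "{SOME k. t + of_int k * \<alpha> \<in> \<int>}"] someI2)
qed

text \<open>A limit of coding sequences follows the coding of a limit of the base points, except at the at most
  two times at which that point hits an end point of the coding intervals.\<close>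
lemma sturmian_subshift_coding:
  assumes \<alpha>: "\<alpha> \<notin> \<rat>" and x: "x \<in> sturmian_subshift \<alpha>"
  shows "\<exists>s. 0 \<le> s \<and> s < 1 \<and> finite {k. x k \<noteq> coding \<alpha> (s + of_int k * \<alpha>)}"
proof -
  interpret Metric_space UNIV shift_dist by (rule Metric_space_shift_dist)
  \<comment> \<open>Base points whose codings agree with \<open>x\<close> on the window
    \<open>[-N, N]\<close>, taken in a compact interval so that a limit \<open>s\<close> can be
    extracted.\<close>
  have "\<exists>t. 0 \<le> t \<and> t \<le> 1 \<and> (\<forall>k. \<bar>k\<bar> \<le> int N \<longrightarrow> x k = coding \<alpha> (t + of_int k * \<alpha>))" for N
  proof -
    have "\<forall>r>0. \<exists>z. shift_dist x (sturmian_sequence \<alpha> z) < r"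
      using x unfolding sturmian_subshift_def metric_closure_of by auto
    moreover have "(0::real) < 1 / 2 ^ N" by simp
    ultimately obtain z where z: "shift_dist x (sturmian_sequence \<alpha> z) < 1 / 2 ^ N" by blast
    define t where "t = frac (circle_rep z)"
    have "circle_rep z = t + of_int \<lfloor>circle_rep z\<rfloor>" by (simp add: t_def frac_def)
    then have zt: "z = to_circle t" by (metis to_circle_add_int to_circle_rep)
    have "x k = coding \<alpha> (t + of_int k * \<alpha>)" if "\<bar>k\<bar> \<le> int N" for k
    proof (rule ccontr)
      assume "x k \<noteq> coding \<alpha> (t + of_int k * \<alpha>)"
      then have "1 / 2 ^ nat \<bar>k\<bar> \<le> shift_dist x (sturmian_sequence \<alpha> z)"
        by (intro shift_dist_ge) (simp add: zt sturmian_sequence_to_circle)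
      moreover have "(1::real) / 2 ^ N \<le> 1 / 2 ^ nat \<bar>k\<bar>"
        using that by (intro divide_left_mono power_increasing) auto
      ultimately show False using z by linarith
    qed
    moreover have "0 \<le> t" "t \<le> 1" using frac_lt_1[of "circle_rep z"] by (auto simp: t_def less_imp_le)
    ultimately show ?thesis by blast
  qed
  then obtain t where t: "\<And>N. t N \<in> {0..1}"
    "\<And>N k. \<bar>k\<bar> \<le> int N \<Longrightarrow> x k = coding \<alpha> (t N + of_int k * \<alpha>)"
    unfolding atLeastAtMost_iff by metis
  have "seq_compact {0..1::real}" using compact_Icc compact_imp_seq_compact by blast
  then obtain s r where r: "strict_mono r" "(t \<circ> r) \<longlonglongrightarrow> s" using t(1) by (metis seq_compactE)
  have exc: "s + of_int k * \<alpha> \<in> \<int> \<or> s + of_int k * \<alpha> + \<alpha> \<in> \<int>" if ne: "x k \<noteq> coding \<alpha> (s + of_int k * \<alpha>)" for k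
  proof (rule ccontr)
    assume "\<not> ?thesis"
    then obtain e where e: "e > 0"
      "\<And>y'. \<bar>y' - (s + of_int k * \<alpha>)\<bar> < e \<Longrightarrow> coding \<alpha> y' = coding \<alpha> (s + of_int k * \<alpha>)"
      using coding_locally_constant by blast
    have "\<forall>\<^sub>F i in sequentially. dist ((t \<circ> r) i) s < e" using r(2) e(1) by (rule tendstoD)
    then obtain i0 where i0: "\<And>i. i \<ge> i0 \<Longrightarrow> dist (t (r i)) s < e"
      unfolding eventually_sequentially by auto
    define i where "i = max i0 (nat \<bar>k\<bar>)"
    have "i \<le> r i" using r(1) by (rule strict_mono_imp_increasing)
    moreover have "\<bar>k\<bar> \<le> int i" by (simp add: i_def)
    ultimately have "\<bar>k\<bar> \<le> int (r i)" by linarith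
    then have "x k = coding \<alpha> (t (r i) + of_int k * \<alpha>)" by (rule t(2))
    also have "\<dots> = coding \<alpha> (s + of_int k * \<alpha>)"
      using i0[of i] by (intro e(2)) (simp add: i_def dist_real_def)
    finally show False using ne by simp
  qed
  let ?A = "{k::int. s + of_int k * \<alpha> \<in> \<int>}"
  \<comment> \<open>Hitting an integer minus \<alpha> at time \<open>k\<close> means hitting an
    integer at time \<open>k + 1\<close>.\<close>
  have "{k. x k \<noteq> coding \<alpha> (s + of_int k * \<alpha>)} \<subseteq> ?A \<union> (\<lambda>k. k - 1) ` ?A"
  proof
    fix k assume "k \<in> {k. x k \<noteq> coding \<alpha> (s + of_int k * \<alpha>)}"
    then have "k \<in> ?A \<or> k + 1 \<in> ?A" using exc[of k] by (simp add: algebra_simps)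
    moreover have "k = (\<lambda>k. k - 1) (k + 1)" by simp
    ultimately show "k \<in> ?A \<union> (\<lambda>k. k - 1) ` ?A" by blast
  qed
  then have fin: "finite {k. x k \<noteq> coding \<alpha> (s + of_int k * \<alpha>)}"
    using finite_irrational_orbit_Ints[OF \<alpha>, of s] by (meson finite_UnI finite_imageI finite_subset)
  \<comment> \<open>The limit \<open>s\<close> may equal 1; \<open>frac\<close> moves it into
    \<open>[0, 1)\<close> without changing the coding.\<close>
  have "coding \<alpha> (frac s + of_int k * \<alpha>) = coding \<alpha> (s + of_int k * \<alpha>)" for k :: int
    using coding_add_int[of \<alpha> "frac s + of_int k * \<alpha>" "\<lfloor>s\<rfloor>"] by (simp add: frac_def algebra_simps)
  with fin have "finite {k. x k \<noteq> coding \<alpha> (frac s + of_int k * \<alpha>)}" by simp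
  then show ?thesis using frac_lt_1[of s] by (intro exI[of _ "frac s"]) simp
qed

text \<open>Sequences \<delta>-apart differ at an index in \<open>[-m, m]\<close>. Up to finitely
  many times this is a difference of codings, hence a cut point between the coordinates moved by
  \<open>j + k\<close> steps.\<close>

lemma Sep_sturmian_le:
  assumes \<alpha>: "\<alpha> \<notin> \<rat>" and "\<delta> > 0"
  shows "\<exists>r. \<forall>M \<nu>. 0 < M \<and> 0 < \<nu> \<and> r < real M * \<nu> \<longrightarrow>
    Sep (sturmian_subshift \<alpha>) shift_dist left_shift \<delta> \<nu> \<le> enat M"
proof -
  obtain m where "(1 / 2) ^ m < \<delta>" using real_arch_pow_inv[of \<delta> "1 / 2"] \<open>\<delta> > 0\<close> by auto
  then have m: "1 / 2 ^ m < \<delta>" by (simp add: power_one_over)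
  obtain g where g: "\<And>x. x \<in> sturmian_subshift \<alpha> \<Longrightarrow> 0 \<le> g x \<and> g x < 1"
    "\<And>x. x \<in> sturmian_subshift \<alpha> \<Longrightarrow> finite {k. x k \<noteq> coding \<alpha> (g x + of_int k * \<alpha>)}"
    using sturmian_subshift_coding[OF \<alpha>] by metis
  \<comment> \<open>The cut points 0 and \<open>- \<alpha>\<close>, pulled back by \<open>j\<close>
    steps, are \<open>- j * \<alpha>\<close> and \<open>- (j + 1) * \<alpha>\<close>; hence the
    range up to \<open>m + 1\<close>.\<close>
  define P where "P = (\<lambda>j::int. - (of_int j * \<alpha>)) ` {- int m..int m + 1}"
  have cut: "\<exists>p\<in>P. \<exists>l::int. min s t + real k * \<alpha> \<le> p + l \<and> p + l \<le> max s t + real k * \<alpha>"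
    if j: "\<bar>j\<bar> \<le> int m" and ne: "coding \<alpha> (s + of_int (j + int k) * \<alpha>) \<noteq> coding \<alpha> (t + of_int (j + int k) * \<alpha>)"
    for s t j and k :: nat
  proof -
    define w where "w = of_int (j + int k) * \<alpha>"
    have w: "w = of_int j * \<alpha> + real k * \<alpha>" by (simp add: w_def algebra_simps)
    have neq: "coding \<alpha> (min s t + w) \<noteq> coding \<alpha> (max s t + w)"
      using ne unfolding w_def by (cases "s \<le> t") (auto simp: min_def max_def)
    have "min s t + w \<le> max s t + w" by simp
    from coding_neq_imp_cut[OF this neq] obtain l :: int where
      "min s t + w \<le> l \<and> l \<le> max s t + w \<or> min s t + w \<le> l - \<alpha> \<and> l - \<alpha> \<le> max s t + w" by blast
    then show ?thesis
    proof
      assume l: "min s t + w \<le> l \<and> l \<le> max s t + w"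
      have "- (of_int j * \<alpha>) \<in> P" unfolding P_def using j by (intro imageI) auto
      moreover have "min s t + real k * \<alpha> \<le> - (of_int j * \<alpha>) + l"
        "- (of_int j * \<alpha>) + l \<le> max s t + real k * \<alpha>" using l unfolding w by linarith+
      ultimately show ?thesis by blast
    next
      assume l: "min s t + w \<le> l - \<alpha> \<and> l - \<alpha> \<le> max s t + w"
      have "- (of_int (j + 1) * \<alpha>) \<in> P" unfolding P_def using j by (intro imageI) auto
      moreover have "- (of_int (j + 1) * \<alpha>) = - (of_int j * \<alpha>) - \<alpha>" by (simp add: algebra_simps)
      moreover have "min s t + real k * \<alpha> \<le> - (of_int j * \<alpha>) - \<alpha> + l"
        "- (of_int j * \<alpha>) - \<alpha> + l \<le> max s t + real k * \<alpha>" using l unfolding w by linarith+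
      ultimately show ?thesis by metis
    qed
  qed
  have "Sep (sturmian_subshift \<alpha>) shift_dist left_shift \<delta> \<nu> \<le> enat M"
    if "0 < M" "0 < \<nu>" "real (card P) < real M * \<nu>" for M \<nu>
  proof (rule Sep_le_rotation_coordinate[OF \<alpha> _ that])
    show "finite P" by (simp add: P_def)
    show "0 \<le> g x \<and> g x < 1" if "x \<in> sturmian_subshift \<alpha>" for x by (rule g(1)[OF that])
    fix x y assume x: "x \<in> sturmian_subshift \<alpha>" and y: "y \<in> sturmian_subshift \<alpha>"
    \<comment> \<open>Indices where \<open>x\<close> or \<open>y\<close> deviates from its coding;
      only finitely many \<open>k\<close> bring one of them into the window
      \<open>[-m, m]\<close>.\<close>
    define A where "A = {k. x k \<noteq> coding \<alpha> (g x + of_int k * \<alpha>)} \<union> {k. y k \<noteq> coding \<alpha> (g y + of_int k * \<alpha>)}"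
    have "finite A" using g(2)[OF x] g(2)[OF y] by (simp add: A_def)
    have "{k. \<delta> \<le> shift_dist ((left_shift ^^ k) x) ((left_shift ^^ k) y) \<and>
       \<not> (\<exists>p\<in>P. \<exists>l::int. min (g x) (g y) + real k * \<alpha> \<le> p + l \<and> p + l \<le> max (g x) (g y) + real k * \<alpha>)}
       \<subseteq> (\<Union>j\<in>{- int m..int m}. (\<lambda>k. j + int k) -` A)" (is "?E \<subseteq> _")
    proof
      fix k assume k: "k \<in> ?E"
      then have "1 / 2 ^ m < shift_dist ((left_shift ^^ k) x) ((left_shift ^^ k) y)" using m by simp
      then obtain j where j: "\<bar>j\<bar> \<le> int m" "x (j + int k) \<noteq> y (j + int k)"
        unfolding funpow_left_shift by (rule shift_dist_gtE)
      have "coding \<alpha> (g x + of_int (j + int k) * \<alpha>) = coding \<alpha> (g y + of_int (j + int k) * \<alpha>)"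
        using cut[OF j(1), where s = "g x" and t = "g y" and k = k] k by blast
      with j(2) have "j + int k \<in> A" by (auto simp: A_def)
      with j(1) show "k \<in> (\<Union>j\<in>{- int m..int m}. (\<lambda>k. j + int k) -` A)" by force
    qed
    moreover have "finite (\<Union>j\<in>{- int m..int m}. (\<lambda>k. j + int k) -` A)"
      using \<open>finite A\<close> by (intro finite_UN_I finite_vimageI) (auto simp: inj_def)
    ultimately show "finite ?E" by (rule finite_subset)
  qed
  then show ?thesis by blast
qed

text \<open>At scale 1 only the symbol at index 0 matters, and the cut point 0 suffices. Coordinates
  in \<open>[0, 1/q)\<close> are close enough for \<open>coding_across_int\<close>.\<close>

lemma le_Sep_sturmian:
  assumes \<alpha>: "0 < \<alpha>" "\<alpha> < 1" "\<alpha> \<notin> \<rat>"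
  shows "\<exists>q>0. \<forall>M>0. enat M \<le> Sep (sturmian_subshift \<alpha>) shift_dist left_shift 1 (1 / (real (q * M) + 1))"
proof -
  interpret Metric_space UNIV shift_dist by (rule Metric_space_shift_dist)
  obtain q :: nat where q: "0 < q" "1 / real q < min \<alpha> (1 - \<alpha>)"
    using \<alpha> real_arch_inverse[of "min \<alpha> (1 - \<alpha>)"] by (auto simp: inverse_eq_divide)
  have range: "range (sturmian_sequence \<alpha>) \<subseteq> sturmian_subshift \<alpha>"
    unfolding sturmian_subshift_def by (rule closure_of_subset) simp
  have "enat M \<le> Sep (sturmian_subshift \<alpha>) shift_dist left_shift 1 (1 / (real (q * M) + 1))"
    if "M > 0" for M
  proof (rule le_Sep_rotation_coordinate[OF \<alpha>(3) q(1) that,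
        where p = 0 and pt = "\<lambda>s. sturmian_sequence \<alpha> (to_circle s)"])
    fix s t k l
    assume st: "0 \<le> s" "s < t" "t < 1 / real q"
      and cut: "s + real k * \<alpha> < 0 + of_int l" "0 + of_int l < t + real k * \<alpha>"
    let ?x = "(left_shift ^^ k) (sturmian_sequence \<alpha> (to_circle s))"
    let ?y = "(left_shift ^^ k) (sturmian_sequence \<alpha> (to_circle t))"
    have "coding \<alpha> (s + real k * \<alpha>) \<noteq> coding \<alpha> (t + real k * \<alpha>)"
      using cut st q(2) \<alpha> by (intro coding_across_int[of _ l]) auto
    then have "?x 0 \<noteq> ?y 0" by (simp add: funpow_left_shift sturmian_sequence_to_circle)
    from shift_dist_ge[of ?x 0 ?y, OF this] show "1 \<le> shift_dist ?x ?y" by simp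
  next
    show "sturmian_sequence \<alpha> (to_circle s) \<in> sturmian_subshift \<alpha>" for s using range by blast
    show "shift_dist x y = shift_dist y x" for x y by (rule commute)
  qed simp_all
  with q(1) show ?thesis by blast
qed

theorem has_ac_sturmian:
  assumes "0 < \<alpha>" "\<alpha> < 1" "\<alpha> \<notin> \<rat>"
  shows "has_ac (sturmian_subshift \<alpha>) shift_dist left_shift 1"
proof -
  obtain q where "q > 0"
    "\<And>M. M > 0 \<Longrightarrow> enat M \<le> Sep (sturmian_subshift \<alpha>) shift_dist left_shift 1 (1 / (real (q * M) + 1))"
    using le_Sep_sturmian[OF assms] by blast
  from has_ac_oneI[OF Sep_sturmian_le[OF assms(3)] _ this] show ?thesis by simp
qed

theorem proposition1p4:
  shows "(\<forall>(X :: 'a set) d f. compact_metric_space X d \<and> X \<noteq> {} \<and> isometry_map X d f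
            \<longrightarrow> has_ac X d f 0)
       \<and> (\<forall>(X :: 'a set) d f. compact_metric_space X d \<and> X \<noteq> {} \<and> morse_smale X d f
            \<longrightarrow> has_ac X d f 0)
       \<and> (\<forall>\<alpha> :: real. 0 < \<alpha> \<and> \<alpha> < 1 \<and> \<alpha> \<notin> \<rat>
            \<longrightarrow> has_ac (sturmian_subshift \<alpha>) shift_dist left_shift 1)
       \<and> (\<forall>f :: circle \<Rightarrow> circle. denjoy_homeomorphism f \<longrightarrow> has_ac UNIV dist f 1)"
  using has_ac_isometry has_ac_morse_smale has_ac_sturmian has_ac_denjoy by blast

end
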